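(* Let $R=\mathbb C[S_1,\ldots,S_n]/I$ be a local algebra of dimension $n+2$ which is an $n$-factor, and let $\rho:\mathbb G_a^n\to\operatorname{GL}(R)$ be $\rho(\alpha)(x)=\exp(\alpha_1S_1+\cdots+\alpha_nS_n)x$. Then the closure of the orbit $\rho(\mathbb G_a^n)\langle1\rangle$ in $\mathbb P(R)\cong\mathbb P^{n+1}$ is a nondegenerate quadric if and only if $\dim_{\mathbb C}\mathfrak m_R^2=1$ and the bilinear form $B_0$ (defined with respect to a proper basis $\mu_1,\ldots,\mu_{n+2}$ with $\mathfrak m_R^2=\langle\mu_{n+2}\rangle$) is nondegenerate. In this case the orbit closure is the quadric $\{[u]\in\mathbb P(R): B_0(u,u)=0\}$.
   Context: A local algebra means a finite-dimensional commutative associative unital $\mathbb C$-algebra with a unique maximal ideal $\mathfrak m_R$ and residue field $\mathbb C$. An $n$-factor is a quotient $\mathbb C[S_1,\ldots,S_n]/I$ in which the images of $S_1,\ldots,S_n$ are linearly independent (they lie in $\mathfrak m_R$, so the exponential is a finite sum). A $\mathbb C$-basis $\mu_1,\ldots,\mu_{n+2}$ of $R$ is proper if $\mu_1=1$, $\mu_2,\ldots,\mu_{n+1}$ are the images of $S_1,\ldots,S_n$, $\mu_{n+2}$ is a polynomial in $\mu_2,\ldots,\mu_{n+1}$, and every power $\mathfrak m_R^k$ is spanned by a subset of the basis. When $\mathfrak m_R^2=\langle\mu_{n+2}\rangle$, $B_0$ is the symmetric bilinear form with $B_0(\mu_1,\mu_j)=-\delta_{j,n+2}$, $B_0(\mu_i,\mu_{n+2})=-\delta_{i,1}$,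 and $B_0(\mu_i,\mu_j)=a_{ij}$ for $i,j=2,\ldots,n+1$, where $\mu_i\mu_j=a_{ij}\mu_{n+2}$. *)

theory Defs
  imports "HOL-Analysis.Analysis"
begin

text \<open>The local algebra R is modelled concretely on the complex vector space
  complex^'m (so dim R = CARD('m)), with a multiplication mul and a unit one.
  Complex-linear notions use the library interpretation vec (scalar multiplication *s).\<close>

definition comm_calg ::
  "(complex^'m \<Rightarrow> complex^'m \<Rightarrow> complex^'m) \<Rightarrow> complex^'m \<Rightarrow> bool" where
  "comm_calg mul one \<longleftrightarrow>
     (\<forall>x y z. mul (x + y) z = mul x z + mul y z) \<and>
     (\<forall>c x y. mul (c *s x) y = c *s mul x y) \<and>
     (\<forall>x y. mul x y = mul y x) \<and>
     (\<forall>x y z. mul (mul x y) z = mul x (mul y z)) \<and>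
     (\<forall>x. mul one x = x)"

definition is_ideal ::
  "(complex^'m \<Rightarrow> complex^'m \<Rightarrow> complex^'m) \<Rightarrow> (complex^'m) set \<Rightarrow> bool" where
  "is_ideal mul I \<longleftrightarrow> vec.subspace I \<and> (\<forall>x\<in>I. \<forall>y. mul y x \<in> I)"

definition is_max_ideal ::
  "(complex^'m \<Rightarrow> complex^'m \<Rightarrow> complex^'m) \<Rightarrow> (complex^'m) set \<Rightarrow> bool" where
  "is_max_ideal mul M \<longleftrightarrow> is_ideal mul M \<and> M \<noteq> UNIV \<and>
     (\<forall>J. is_ideal mul J \<and> M \<subseteq> J \<longrightarrow> J = M \<or> J = UNIV)"

text \<open>Local algebra: finite-dimensional commutative associative unital C-algebra with a
  unique maximal ideal whose residue field is C (i.e. the maximal ideal has codimension 1).\<close>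
definition local_calg ::
  "(complex^'m \<Rightarrow> complex^'m \<Rightarrow> complex^'m) \<Rightarrow> complex^'m \<Rightarrow> bool" where
  "local_calg mul one \<longleftrightarrow> comm_calg mul one \<and>
     (\<exists>!M. is_max_ideal mul M) \<and>
     (\<forall>M. is_max_ideal mul M \<longrightarrow> vec.dim M + 1 = CARD('m))"

definition max_ideal ::
  "(complex^'m \<Rightarrow> complex^'m \<Rightarrow> complex^'m) \<Rightarrow> (complex^'m) set" where
  "max_ideal mul = (THE M. is_max_ideal mul M)"

fun ideal_pow ::
  "(complex^'m \<Rightarrow> complex^'m \<Rightarrow> complex^'m) \<Rightarrow> complex^'m \<Rightarrow> (complex^'m) set \<Rightarrow> nat \<Rightarrow> (complex^'m) set" where
  "ideal_pow mul one M 0 = UNIV"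
| "ideal_pow mul one M (Suc k) = vec.span {mul x y | x y. x \<in> M \<and> y \<in> ideal_pow mul one M k}"

fun apow ::
  "(complex^'m \<Rightarrow> complex^'m \<Rightarrow> complex^'m) \<Rightarrow> complex^'m \<Rightarrow> complex^'m \<Rightarrow> nat \<Rightarrow> complex^'m" where
  "apow mul one x 0 = one"
| "apow mul one x (Suc k) = mul x (apow mul one x k)"

definition monomial ::
  "(complex^'m \<Rightarrow> complex^'m \<Rightarrow> complex^'m) \<Rightarrow> complex^'m \<Rightarrow> nat \<Rightarrow> (nat \<Rightarrow> complex^'m) \<Rightarrow> (nat \<Rightarrow> nat) \<Rightarrow> complex^'m" where
  "monomial mul one n s k = foldr mul (map (\<lambda>i. apow mul one (s i) (k i)) [1..<n+1]) one"

definition polys ::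
  "(complex^'m \<Rightarrow> complex^'m \<Rightarrow> complex^'m) \<Rightarrow> complex^'m \<Rightarrow> nat \<Rightarrow> (nat \<Rightarrow> complex^'m) \<Rightarrow> (complex^'m) set" where
  "polys mul one n s = vec.span (range (monomial mul one n s))"

text \<open>n-factor: R = C[S_1..S_n]/I, where s i (i = 1..n) are the images of the S_i:
  R is generated as an algebra by the s i, they are linearly independent and lie in m_R.\<close>
definition n_factor ::
  "(complex^'m \<Rightarrow> complex^'m \<Rightarrow> complex^'m) \<Rightarrow> complex^'m \<Rightarrow> nat \<Rightarrow> (nat \<Rightarrow> complex^'m) \<Rightarrow> bool" where
  "n_factor mul one n s \<longleftrightarrow>
     polys mul one n s = UNIV \<and>
     inj_on s {1..n} \<and> vec.independent (s ` {1..n}) \<and>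
     s ` {1..n} \<subseteq> max_ideal mul"

text \<open>Exponential of a nilpotent element (finite sum; x^k = 0 for k \<ge> dim R when x is in m_R).\<close>
definition aexp ::
  "(complex^'m \<Rightarrow> complex^'m \<Rightarrow> complex^'m) \<Rightarrow> complex^'m \<Rightarrow> complex^'m \<Rightarrow> complex^'m" where
  "aexp mul one x = (\<Sum>k\<le>CARD('m). (1 / of_nat (fact k)) *s apow mul one x k)"

definition rho ::
  "(complex^'m \<Rightarrow> complex^'m \<Rightarrow> complex^'m) \<Rightarrow> complex^'m \<Rightarrow> nat \<Rightarrow> (nat \<Rightarrow> complex^'m) \<Rightarrow> (nat \<Rightarrow> complex) \<Rightarrow> complex^'m \<Rightarrow> complex^'m" where
  "rho mul one n s \<alpha> x = mul (aexp mul one (\<Sum>i\<in>{1..n}. \<alpha> i *s s i)) x"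

text \<open>Affine cone over the orbit rho(G_a^n)<1> in P(R): all nonzero multiples of orbit points.
  Its closure in R is the affine cone over the closure of the orbit in P(R).\<close>
definition orbit_cone ::
  "(complex^'m \<Rightarrow> complex^'m \<Rightarrow> complex^'m) \<Rightarrow> complex^'m \<Rightarrow> nat \<Rightarrow> (nat \<Rightarrow> complex^'m) \<Rightarrow> (complex^'m) set" where
  "orbit_cone mul one n s = {c *s rho mul one n s \<alpha> one | c \<alpha>. c \<noteq> 0}"

definition sym_cbilinear :: "(complex^'m \<Rightarrow> complex^'m \<Rightarrow> complex) \<Rightarrow> bool" where
  "sym_cbilinear B \<longleftrightarrow>
     (\<forall>x y z. B (x + y) z = B x z + B y z) \<and>
     (\<forall>c x y. B (c *s x) y = c * B x y) \<and>
     (\<forall>x y. B x y = B y x)"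

definition nondegenerate :: "(complex^'m \<Rightarrow> complex^'m \<Rightarrow> complex) \<Rightarrow> bool" where
  "nondegenerate B \<longleftrightarrow> (\<forall>u. (\<forall>v. B u v = 0) \<longrightarrow> u = 0)"

text \<open>The (projective closure of the) set, given by its affine cone C, is a nondegenerate
  quadric: C = {u. B(u,u) = 0} for a nondegenerate symmetric bilinear form B.\<close>
definition nondeg_quadric_cone :: "(complex^'m) set \<Rightarrow> bool" where
  "nondeg_quadric_cone C \<longleftrightarrow>
     (\<exists>B. sym_cbilinear B \<and> nondegenerate B \<and> C = {u. B u u = 0})"

definition proper_basis ::
  "(complex^'m \<Rightarrow> complex^'m \<Rightarrow> complex^'m) \<Rightarrow> complex^'m \<Rightarrow> nat \<Rightarrow> (nat \<Rightarrow> complex^'m) \<Rightarrow> (nat \<Rightarrow> complex^'m) \<Rightarrow> bool" where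
  "proper_basis mul one n s \<mu> \<longleftrightarrow>
     inj_on \<mu> {1..n+2} \<and> vec.independent (\<mu> ` {1..n+2}) \<and> vec.span (\<mu> ` {1..n+2}) = UNIV \<and>
     \<mu> 1 = one \<and> (\<forall>i\<in>{1..n}. \<mu> (i+1) = s i) \<and> \<mu> (n+2) \<in> polys mul one n s \<and>
     (\<forall>k. \<exists>J\<subseteq>{1..n+2}. ideal_pow mul one (max_ideal mul) k = vec.span (\<mu> ` J))"

definition coord :: "nat \<Rightarrow> (nat \<Rightarrow> complex^'m) \<Rightarrow> complex^'m \<Rightarrow> nat \<Rightarrow> complex" where
  "coord n \<mu> u i = vec.representation (\<mu> ` {1..n+2}) u (\<mu> i)"

definition struct_a ::
  "(complex^'m \<Rightarrow> complex^'m \<Rightarrow> complex^'m) \<Rightarrow> nat \<Rightarrow> (nat \<Rightarrow> complex^'m) \<Rightarrow> nat \<Rightarrow> nat \<Rightarrow> complex" where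
  "struct_a mul n \<mu> i j = (THE a. mul (\<mu> i) (\<mu> j) = a *s \<mu> (n+2))"

definition B0_basis ::
  "(complex^'m \<Rightarrow> complex^'m \<Rightarrow> complex^'m) \<Rightarrow> nat \<Rightarrow> (nat \<Rightarrow> complex^'m) \<Rightarrow> nat \<Rightarrow> nat \<Rightarrow> complex" where
  "B0_basis mul n \<mu> i j =
     (if i = 1 then (if j = n+2 then -1 else 0)
      else if j = 1 then (if i = n+2 then -1 else 0)
      else if i = n+2 \<or> j = n+2 then 0
      else struct_a mul n \<mu> i j)"

definition B0 ::
  "(complex^'m \<Rightarrow> complex^'m \<Rightarrow> complex^'m) \<Rightarrow> nat \<Rightarrow> (nat \<Rightarrow> complex^'m) \<Rightarrow> complex^'m \<Rightarrow> complex^'m \<Rightarrow> complex" where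
  "B0 mul n \<mu> u v =
     (\<Sum>i\<in>{1..n+2}. \<Sum>j\<in>{1..n+2}. coord n \<mu> u i * coord n \<mu> v j * B0_basis mul n \<mu> i j)"

end

theory Submission
  imports Defs
begin

text \<open>Write \<open>V\<close> for the span of the \<open>S\<^sub>i\<close> and \<open>M\<close> for the maximal ideal.
  If \<open>M\<^sup>2\<close> is spanned by \<open>e\<close>, then \<open>M\<^sup>3 = 0\<close> by Nakayama, so \<open>exp v = 1 + v + v\<^sup>2 / 2\<close> and the
  cone over the orbit is the part of the quadric \<open>B\<^sub>0(u, u) = 0\<close> where the coordinate of \<open>1\<close> is
  nonzero; this part is dense because \<open>B\<^sub>0\<close> does not vanish on \<open>V\<close>.

  Conversely, let the orbit closure be the quadric of a nondegenerate form \<open>B\<close>. For \<open>v\<close> in \<open>V\<close> the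
  form \<open>B(v x, y) + B(x, v y)\<close> vanishes on the orbit, hence on the quadric, so it is a multiple of
  \<open>B\<close>, and the factor is zero as \<open>v\<close> is nilpotent. Thus multiplication by \<open>v\<close> is skew for \<open>B\<close>, and
  \<open>M\<close> is the sum of its skew and its self-adjoint elements. The functional \<open>B(1, -)\<close> vanishes on the
  skew elements; counting dimensions, these form exactly \<open>V\<close>, and the self-adjoint ones form a line
  \<open>\<langle>e\<rangle>\<close>. Then \<open>e\<^sup>2 = 0\<close>, \<open>V e = 0\<close> and \<open>V V = \<langle>e\<rangle>\<close>, so \<open>M\<^sup>2 = \<langle>e\<rangle>\<close> and \<open>B\<close> is a multiple
  of \<open>B\<^sub>0\<close>.\<close>

section \<open>Local algebras\<close>

locale local_algebra =
  fixes mul :: "complex^'m \<Rightarrow> complex^'m \<Rightarrow> complex^'m" (infixl "\<odot>" 70)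
    and one :: "complex^'m"
  assumes loc: "local_calg mul one"
begin

abbreviation M :: "(complex^'m) set" where "M \<equiv> max_ideal mul"
abbreviation P :: "nat \<Rightarrow> (complex^'m) set" where "P \<equiv> ideal_pow mul one M"
abbreviation pw :: "complex^'m \<Rightarrow> nat \<Rightarrow> complex^'m" where "pw \<equiv> apow mul one"

lemma
  shows mul_add_left: "(x + y) \<odot> z = x \<odot> z + y \<odot> z"
    and mul_scale_left: "(c *s x) \<odot> y = c *s (x \<odot> y)"
    and mul_commute: "x \<odot> y = y \<odot> x"
    and mul_assoc: "(x \<odot> y) \<odot> z = x \<odot> (y \<odot> z)"
    and one_mul [simp]: "one \<odot> x = x"
proof -
  have "comm_calg mul one" using loc by (simp add: local_calg_def)
  note laws = this[unfolded comm_calg_def]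
  show "(x + y) \<odot> z = x \<odot> z + y \<odot> z" using laws by metis
  show "(c *s x) \<odot> y = c *s (x \<odot> y)" using laws by metis
  show "x \<odot> y = y \<odot> x" using laws by metis
  show "(x \<odot> y) \<odot> z = x \<odot> (y \<odot> z)" using laws by metis
  show "one \<odot> x = x" using laws by metis
qed

lemma mul_add_right: "z \<odot> (x + y) = z \<odot> x + z \<odot> y"
  by (metis mul_add_left mul_commute)

lemma mul_scale_right: "x \<odot> (c *s y) = c *s (x \<odot> y)"
  by (metis mul_scale_left mul_commute)

lemma mul_one [simp]: "x \<odot> one = x"
  by (metis mul_commute one_mul)

lemma mul_left_commute: "x \<odot> (y \<odot> z) = y \<odot> (x \<odot> z)"
  by (metis mul_assoc mul_commute)

lemma mul_zero_left [simp]: "0 \<odot> x = 0"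
  using mul_scale_left[of 0 0 x] by simp

lemma mul_zero_right [simp]: "x \<odot> 0 = 0"
  by (metis mul_zero_left mul_commute)

lemma mul_minus_left: "(- x) \<odot> y = - (x \<odot> y)"
  using mul_scale_left[of "-1" x y] by simp

lemma mul_diff_left: "(x - y) \<odot> z = x \<odot> z - y \<odot> z"
  using mul_add_left[of x "- y" z] by (simp add: mul_minus_left)

lemma mul_sum_right: "x \<odot> sum f A = (\<Sum>a\<in>A. x \<odot> f a)"
  by (induction A rule: infinite_finite_induct) (simp_all add: mul_add_right)

section \<open>The maximal ideal and the units outside it\<close>

lemma is_max_ideal_M: "is_max_ideal mul M"
  using loc unfolding local_calg_def max_ideal_def by (metis theI')

lemma max_ideal_unique: "is_max_ideal mul J \<Longrightarrow> J = M"
  using loc is_max_ideal_M unfolding local_calg_def by blast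

lemma ideal_M: "is_ideal mul M" and M_neq_UNIV: "M \<noteq> UNIV"
  using is_max_ideal_M unfolding is_max_ideal_def by auto

lemma dim_M: "vec.dim M + 1 = CARD('m)"
  using loc is_max_ideal_M unfolding local_calg_def by blast

lemma subspace_M: "vec.subspace M"
  using ideal_M unfolding is_ideal_def by blast

lemma ideal_mul: "is_ideal mul I \<Longrightarrow> x \<in> I \<Longrightarrow> y \<odot> x \<in> I"
  unfolding is_ideal_def by blast

lemma mul_mem_M: "x \<in> M \<Longrightarrow> y \<odot> x \<in> M"
  using ideal_M ideal_mul by blast

lemma one_notin_M: "one \<notin> M"
proof
  assume "one \<in> M"
  then have "y \<in> M" for y using mul_mem_M[of one y] by simp
  then show False using M_neq_UNIV by auto
qed

lemma is_ideal_strict_dim: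
  assumes "is_ideal mul I" "is_ideal mul J" "I \<subset> J"
  shows "vec.dim I < vec.dim J"
proof -
  have "vec.span I = I" "vec.span J = J"
    using assms by (auto simp: is_ideal_def vec.span_eq_iff)
  then show ?thesis using assms(3) vec.dim_psubset[of I J] by metis
qed

text \<open>A strict inclusion of ideals raises the dimension, which is at most
  \<open>CARD('m)\<close>, so an ideal of greatest dimension satisfying \<open>Q\<close> is maximal
  with that property.\<close>

lemma ex_maximal_ideal:
  assumes "Q I" "\<And>J. Q J \<Longrightarrow> is_ideal mul J"
  shows "\<exists>J. Q J \<and> (\<forall>K. Q K \<and> J \<subseteq> K \<longrightarrow> K = J)"
proof -
  have "\<forall>K. Q K \<longrightarrow> vec.dim K < CARD('m) + 1"
    using dim_subset_UNIV_cart_gen[where 'a=complex and 'n='m] by (simp add: less_Suc_eq_le)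
  then obtain J where J: "Q J" "\<And>K. Q K \<Longrightarrow> vec.dim K \<le> vec.dim J"
    using ex_has_greatest_nat[of Q I vec.dim "CARD('m) + 1"] assms(1) by blast
  have "K = J" if "Q K" "J \<subseteq> K" for K
    using is_ideal_strict_dim[of J K] J that assms(2) by fastforce
  with J(1) show ?thesis by blast
qed

text \<open>An ideal that is maximal among the proper ones containing \<open>J\<close> is a maximal
  ideal outright, hence equal to \<open>M\<close> by uniqueness.\<close>

lemma proper_ideal_subset_M:
  assumes J: "is_ideal mul J" "J \<noteq> UNIV"
  shows "J \<subseteq> M"
proof -
  let ?Q = "\<lambda>K. is_ideal mul K \<and> K \<noteq> UNIV \<and> J \<subseteq> K"
  have "?Q J" using J by simp
  then obtain K where K: "?Q K" and max: "\<And>L. ?Q L \<Longrightarrow> K \<subseteq> L \<Longrightarrow> L = K"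
    using ex_maximal_ideal[of ?Q J] by metis
  have "is_max_ideal mul K"
    unfolding is_max_ideal_def using K max by blast
  then show ?thesis using K max_ideal_unique by metis
qed

text \<open>The principal ideal generated by \<open>x\<close> is not contained in \<open>M\<close>,
  so it cannot be proper and must contain \<open>one\<close>.\<close>

lemma unit_if_notin_M:
  assumes "x \<notin> M"
  obtains y where "y \<odot> x = one"
proof -
  let ?J = "range (\<lambda>y. y \<odot> x)"
  have "is_ideal mul ?J"
    unfolding is_ideal_def vec.subspace_def
  proof (intro conjI ballI allI)
    show "0 \<in> ?J" by (rule image_eqI[of _ _ 0]) simp_all
  next
    fix u v assume "u \<in> ?J" "v \<in> ?J"
    then obtain a b where "u = a \<odot> x" "v = b \<odot> x" by blast
    then have "u + v = (a + b) \<odot> x" by (simp only: mul_add_left)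
    then show "u + v \<in> ?J" by (rule image_eqI) simp
  next
    fix c u assume "u \<in> ?J"
    then obtain a where "u = a \<odot> x" by blast
    then have "c *s u = (c *s a) \<odot> x" by (simp only: mul_scale_left)
    then show "c *s u \<in> ?J" by (rule image_eqI) simp
  next
    fix u v assume "u \<in> ?J"
    then obtain a where "u = a \<odot> x" by blast
    then have "v \<odot> u = (v \<odot> a) \<odot> x" by (simp only: mul_assoc)
    then show "v \<odot> u \<in> ?J" by (rule image_eqI) simp
  qed
  moreover have "x \<in> ?J" by (rule image_eqI[of _ _ one]) auto
  ultimately have "?J = UNIV" using proper_ideal_subset_M assms by blast
  then have "one \<in> ?J" by simp
  then show ?thesis using that by auto
qed

section \<open>Nakayama's lemma and the powers of the maximal ideal\<close>

abbreviation M_times :: "(complex^'m) set \<Rightarrow> (complex^'m) set" where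
  "M_times W \<equiv> vec.span {x \<odot> y | x y. x \<in> M \<and> y \<in> W}"

lemma is_ideal_M_times:
  assumes "is_ideal mul W"
  shows "is_ideal mul (M_times W)"
  unfolding is_ideal_def
proof (intro conjI ballI allI)
  fix x z assume "x \<in> M_times W"
  then show "z \<odot> x \<in> M_times W"
  proof (induction rule: vec.span_induct_alt)
    case base
    then show ?case by (simp add: vec.span_zero)
  next
    case (step c x y)
    then obtain a b where "a \<in> M" "b \<in> W" "x = a \<odot> b" by auto
    then have "z \<odot> x = (z \<odot> a) \<odot> b" "z \<odot> a \<in> M" by (auto simp: mul_assoc mul_mem_M)
    then have "z \<odot> x \<in> M_times W" using \<open>b \<in> W\<close> by (intro vec.span_base) blast
    then show ?case using step
      by (simp add: mul_add_right mul_scale_right vec.span_add vec.span_scale)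
  qed
qed simp

lemma M_times_subset: "is_ideal mul W \<Longrightarrow> M_times W \<subseteq> W"
  by (rule vec.span_minimal) (auto simp: is_ideal_def)

text \<open>Nakayama's lemma: a maximal proper subideal of \<open>W\<close> already contains \<open>M \<odot> W\<close>.\<close>
lemma M_times_psubset:
  assumes W: "is_ideal mul W" "W \<noteq> {0}"
  shows "M_times W \<subset> W"
proof -
  have zero: "is_ideal mul {0}" by (auto simp: is_ideal_def)
  have "0 \<in> W" using W(1) by (auto simp: is_ideal_def vec.subspace_0)
  let ?Q = "\<lambda>K. is_ideal mul K \<and> K \<subset> W"
  have "?Q {0}" using zero \<open>0 \<in> W\<close> W(2) by blast
  then obtain U where "?Q U" and max: "\<And>L. ?Q L \<Longrightarrow> U \<subseteq> L \<Longrightarrow> L = U"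
    using ex_maximal_ideal[of ?Q "{0}"] by metis
  then have U: "is_ideal mul U" "U \<subset> W" by simp_all
  have "a \<odot> w \<in> U" if a: "a \<in> M" and w: "w \<in> W" for a w
  proof (cases "w \<in> U")
    case True
    then show ?thesis using U(1) ideal_mul by blast
  next
    case False
    \<comment> \<open>The ideal \<open>?L\<close> lies between \<open>U\<close> and
      \<open>W\<close>. If it contained \<open>w\<close>, then \<open>(one - b) \<odot> w\<close>
      would lie in \<open>U\<close> with \<open>one - b\<close> a unit, forcing \<open>w\<close>
      into \<open>U\<close>. So it is strictly below \<open>W\<close>, and maximality gives
      \<open>?L = U\<close>.\<close>
    let ?L = "{u + b \<odot> w | u b. u \<in> U \<and> b \<in> M}"
    have zeros: "0 \<in> U" "0 \<in> M"
      using U(1) subspace_M by (simp_all add: is_ideal_def vec.subspace_0)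
    have LI: "u + b \<odot> w \<in> ?L" if "u \<in> U" "b \<in> M" for u b
      using that by blast
    have L: "is_ideal mul ?L"
      unfolding is_ideal_def vec.subspace_def
    proof (intro conjI ballI allI)
      show "0 \<in> ?L" using LI[OF zeros] by simp
    next
      fix x y assume "x \<in> ?L" "y \<in> ?L"
      then obtain u b u' b' where "x = u + b \<odot> w" "y = u' + b' \<odot> w" "u \<in> U" "u' \<in> U" "b \<in> M" "b' \<in> M"
        by auto
      then have "x + y = (u + u') + (b + b') \<odot> w" "u + u' \<in> U" "b + b' \<in> M"
        using U(1) subspace_M by (auto simp: is_ideal_def vec.subspace_add mul_add_left)
      then show "x + y \<in> ?L" by blast
    next
      fix c x assume "x \<in> ?L"
      then obtain u b where "x = u + b \<odot> w" "u \<in> U" "b \<in> M" by auto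
      then have "c *s x = c *s u + (c *s b) \<odot> w" "c *s u \<in> U" "c *s b \<in> M"
        using U(1) subspace_M
        by (auto simp: is_ideal_def vec.subspace_scale mul_scale_left vec.scale_right_distrib)
      then show "c *s x \<in> ?L" by blast
    next
      fix x y assume "x \<in> ?L"
      then obtain u b where "x = u + b \<odot> w" "u \<in> U" "b \<in> M" by auto
      then have "y \<odot> x = y \<odot> u + (y \<odot> b) \<odot> w" "y \<odot> u \<in> U" "y \<odot> b \<in> M"
        using U(1) by (auto simp: ideal_mul mul_mem_M mul_add_right mul_assoc)
      then show "y \<odot> x \<in> ?L" by blast
    qed
    have UL: "U \<subseteq> ?L"
      using LI[OF _ zeros(2)] by auto
    have LW: "?L \<subseteq> W"
      using U W w by (auto simp: is_ideal_def intro!: vec.subspace_add)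
    have aw: "a \<odot> w \<in> ?L"
      using LI[OF zeros(1) a] by simp
    have "w \<notin> ?L"
    proof
      assume "w \<in> ?L"
      then obtain u b where ub: "w = u + b \<odot> w" "u \<in> U" "b \<in> M" by auto
      have "one - b \<notin> M"
        using ub(3) one_notin_M subspace_M vec.subspace_add[of M "one - b" b] by auto
      then obtain y where y: "y \<odot> (one - b) = one" by (rule unit_if_notin_M)
      have "(one - b) \<odot> w = u" using ub(1) by (metis add_diff_cancel_right' mul_diff_left one_mul)
      then have "w = y \<odot> u" by (metis mul_assoc one_mul y)
      then show False using False U(1) ub(2) ideal_mul by blast
    qed
    then have "?L \<subset> W" using LW w by blast
    then show ?thesis using max[OF _ UL] L aw by simp
  qed
  then have "M_times W \<subseteq> U"
    using U(1) by (intro vec.span_minimal) (auto simp: is_ideal_def)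
  then show ?thesis using U(2) by blast
qed

lemma is_ideal_P: "is_ideal mul (P k)"
  by (induction k) (auto simp: is_ideal_M_times, auto simp: is_ideal_def)

lemma subspace_P: "vec.subspace (P k)"
  using is_ideal_P by (auto simp: is_ideal_def)

lemma P_1: "P (Suc 0) = M"
proof
  have "x \<odot> y \<in> M" if "x \<in> M" for x y
    using mul_mem_M[OF that, of y] by (simp add: mul_commute)
  then show "P (Suc 0) \<subseteq> M"
    using subspace_M unfolding ideal_pow.simps by (intro vec.span_minimal) blast+
  show "M \<subseteq> P (Suc 0)"
  proof
    fix x assume "x \<in> M"
    then have "\<exists>a b. x = a \<odot> b \<and> a \<in> M \<and> b \<in> P 0"
      by (intro exI[of _ x] exI[of _ one]) simp
    then show "x \<in> P (Suc 0)"
      unfolding ideal_pow.simps by (intro vec.span_base) blast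
  qed
qed

lemma P_antimono: "j \<le> k \<Longrightarrow> P k \<subseteq> P j"
proof (induction k rule: dec_induct)
  case (step k)
  then show ?case using M_times_subset[OF is_ideal_P[of k]] by auto
qed simp

lemma P_Suc_psubset: "P k \<noteq> {0} \<Longrightarrow> P (Suc k) \<subset> P k"
  using M_times_psubset[OF is_ideal_P[of k]] by simp

text \<open>By Nakayama every nonzero power loses at least one dimension to the next, so the powers
  vanish from exponent \<open>CARD('m)\<close> on.\<close>

lemma dim_P: "vec.dim (P k) + k \<le> CARD('m) \<or> P k = {0}"
proof (induction k)
  case 0
  then show ?case by (simp add: card_cart_basis)
next
  case (Suc k)
  have "P (Suc k) = {0}" if "P k = {0}"
    using P_antimono[of k "Suc k"] that vec.subspace_0[OF subspace_P[of "Suc k"]] by auto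
  moreover have "vec.dim (P (Suc k)) < vec.dim (P k)" if "P k \<noteq> {0}"
    using is_ideal_strict_dim[OF is_ideal_P is_ideal_P P_Suc_psubset[OF that]] .
  ultimately show ?case using Suc by fastforce
qed

lemma P_eq_0:
  assumes "CARD('m) \<le> k"
  shows "P k = {0}"
proof -
  have "P (CARD('m)) = {0}"
    using dim_P[of "CARD('m)"] vec.subspace_0[OF subspace_P] by (auto simp: vec.dim_eq_0)
  then show ?thesis
    using P_antimono[OF assms] vec.subspace_0[OF subspace_P[of k]] by auto
qed

lemma mul_mem_P: "x \<in> M \<Longrightarrow> y \<in> P k \<Longrightarrow> x \<odot> y \<in> P (Suc k)"
  unfolding ideal_pow.simps by (rule vec.span_base) blast

lemma pw_mem_P: "x \<in> M \<Longrightarrow> pw x k \<in> P k"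
  by (induction k) (auto intro: mul_mem_P simp del: ideal_pow.simps(2))

end

section \<open>Symmetric bilinear forms\<close>

lemma scaleR_eq_scale: "r *\<^sub>R x = complex_of_real r *s (x :: complex^'m)"
  unfolding vec_eq_iff vector_scaleR_component vector_smult_component
  by (simp add: scaleR_conv_of_real)

locale symmetric_form =
  fixes B :: "complex^'m \<Rightarrow> complex^'m \<Rightarrow> complex"
  assumes sym_cbilinear: "sym_cbilinear B"
begin

lemma
  shows add_left: "B (x + y) z = B x z + B y z"
    and scale_left: "B (c *s x) y = c * B x y"
    and commute: "B x y = B y x"
  using sym_cbilinear unfolding sym_cbilinear_def by metis+

lemma add_right: "B x (y + z) = B x y + B x z"
  by (metis add_left commute)

lemma scale_right: "B x (c *s y) = c * B x y"
  by (metis scale_left commute)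

lemma zero_left [simp]: "B 0 x = 0"
  using scale_left[of 0 0 x] by simp

lemma zero_right [simp]: "B x 0 = 0"
  using scale_right[of x 0 0] by simp

lemma minus_left: "B (- x) y = - B x y"
  using scale_left[of "-1" x y] by simp

lemma diff_left: "B (x - y) z = B x z - B y z"
  using add_left[of x "- y" z] by (simp add: minus_left)

lemma diff_right: "B z (x - y) = B z x - B z y"
  by (metis diff_left commute)

lemmas bilinear_simps = add_left add_right scale_left scale_right diff_left diff_right

lemma bounded_bilinear: "bounded_bilinear B"
  unfolding bilinear_conv_bounded_bilinear[symmetric] bilinear_def
  by (auto intro!: linearI simp: bilinear_simps scaleR_eq_scale scaleR_conv_of_real)

lemma closed_isotropic: "closed {u. B u u = 0}"
  by (intro closed_Collect_eq continuous_intros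
      bounded_bilinear.continuous_on[OF bounded_bilinear])

lemma polarization:
  assumes "sym_cbilinear D" "\<And>u. D u u = c * B u u"
  shows "D u v = c * B u v"
proof -
  interpret D: symmetric_form D by unfold_locales fact
  have "D (u + v) (u + v) = D u u + 2 * D u v + D v v"
    by (simp add: D.add_left D.add_right D.commute[of v u])
  moreover have "B (u + v) (u + v) = B u u + 2 * B u v + B v v"
    by (simp add: add_left add_right commute[of v u])
  ultimately have "c * B u u + 2 * D u v + c * B v v = c * (B u u + 2 * B u v + B v v)"
    using assms(2)[of "u + v"] assms(2)[of u] assms(2)[of v] by simp
  then show ?thesis by (simp add: algebra_simps)
qed

lemma span_eqI:
  assumes "sym_cbilinear D" "vec.span S = UNIV"
    and S: "\<And>u v. u \<in> S \<Longrightarrow> v \<in> S \<Longrightarrow> D u v = c * B u v"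
  shows "D u v = c * B u v"
proof -
  interpret D: symmetric_form D by unfold_locales fact
  have 1: "D u v = c * B u v" if "u \<in> S" for u v
  proof -
    have "v \<in> vec.span S" using assms(2) by simp
    then show ?thesis
      by (induction rule: vec.span_induct_alt)
        (simp_all add: S[OF that] D.add_right D.scale_right bilinear_simps algebra_simps)
  qed
  have "u \<in> vec.span S" using assms(2) by simp
  then show ?thesis
    by (induction rule: vec.span_induct_alt)
      (simp_all add: 1 D.add_left D.scale_left bilinear_simps algebra_simps)
qed

text \<open>Complete the isotropic vector \<open>x\<close> to a hyperbolic pair \<open>x, y\<close> and test the hypothesis on
  \<open>w + a x + b y\<close> with \<open>w\<close> orthogonal to both and \<open>2 a b = - B w w\<close>.\<close>
lemma proportional_if_isotropic_subset:
  assumes nondeg: "nondegenerate B" and x: "x \<noteq> 0" "B x x = 0"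
    and D: "sym_cbilinear D" and iso: "\<And>u. B u u = 0 \<Longrightarrow> D u u = 0"
  obtains c where "\<And>u v. D u v = c * B u v"
proof -
  interpret D: symmetric_form D by unfold_locales fact
  obtain z where z: "B x z \<noteq> 0" using nondeg x(1) unfolding nondegenerate_def by metis
  define y0 where "y0 = (1 / B x z) *s z"
  have y0: "B x y0 = 1" using z by (simp add: y0_def scale_right)
  \<comment> \<open>Subtracting this multiple of the isotropic vector \<open>x\<close> makes
    \<open>y\<close> isotropic and keeps its product with \<open>x\<close> equal to 1.\<close>
  define y where "y = y0 - (B y0 y0 / 2) *s x"
  have xy: "B x y = 1" "B y x = 1"
    using y0 x(2) by (simp_all add: y_def bilinear_simps commute[of y0 x])
  have yy: "B y y = 0"
    using y0 x(2) by (simp add: y_def bilinear_simps commute[of y0 x])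
  define c where "c = D x y"
  have Dx: "D x x = 0" and Dy: "D y y = 0" using iso x(2) yy by auto
  have "D u u = c * B u u" for u
  proof -
    \<comment> \<open>The component of \<open>u\<close> orthogonal to the hyperbolic plane of
      \<open>x\<close> and \<open>y\<close>; the coefficient of each of the two vectors is the
      product of \<open>u\<close> with the other one.\<close>
    define w where "w = u - B u y *s x - B x u *s y"
    define q where "q = B w w"
    have wx: "B w x = 0" "B x w = 0" and wy: "B w y = 0" "B y w = 0"
      using x(2) xy yy by (simp_all add: w_def bilinear_simps commute[of u x] commute[of y u])
    have B_expand: "B (w + a *s x + b *s y) (w + a *s x + b *s y) = q + 2 * a * b" for a b
      using wx wy xy yy x(2) by (simp add: bilinear_simps q_def algebra_simps)
    have D_expand: "D (w + a *s x + b *s y) (w + a *s x + b *s y)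
        = D w w + 2 * a * D w x + 2 * b * D w y + 2 * a * b * c" for a b
      using Dx Dy D.commute[of x w] D.commute[of y w] D.commute[of y x]
      by (simp add: D.bilinear_simps c_def algebra_simps)
    have test: "D w w + 2 * a * D w x + 2 * b * D w y + 2 * a * b * c = 0"
      if "q + 2 * a * b = 0" for a b
      using iso[of "w + a *s x + b *s y"] that unfolding B_expand D_expand .
    \<comment> \<open>Three points of the hyperbola \<open>2 * a * b = - q\<close>. The first two
      differ by a sign and add up to \<open>D w w = q * c\<close>; the third has another ratio of
      \<open>a\<close> to \<open>b\<close> and so separates \<open>D w y\<close> from
      \<open>q * D w x\<close>.\<close>
    have t1: "D w w - q * D w x + 2 * D w y - q * c = 0" using test[of "- q / 2" 1] by simp
    have t2: "D w w + q * D w x - 2 * D w y - q * c = 0" using test[of "q / 2" "-1"] by simp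
    have t3: "2 * D w w - q * D w x + 8 * D w y - 2 * (q * c) = 0"
      using test[of "- q / 4" 2] by (simp add: field_simps)
    have Dww: "D w w = q * c" using t1 t2 by algebra
    have Dwy: "D w y = 0" and qDwx: "q * D w x = 0"
      using t1 t2 t3 by algebra+
    \<comment> \<open>If \<open>q = 0\<close>, the previous equations say nothing about
      \<open>D w x\<close>, but then \<open>w + x\<close> is itself isotropic and can be
      tested.\<close>
    have Dwx: "D w x = 0"
    proof (cases "q = 0")
      case True
      then show ?thesis using test[of 1 0] Dww by simp
    qed (use qDwx in simp)
    have u: "u = w + B u y *s x + B x u *s y" by (simp add: w_def)
    show ?thesis
      by (subst (1 2) u, subst (3 4) u)
        (simp only: B_expand D_expand Dww Dwx Dwy, simp add: algebra_simps)
  qed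
  then show ?thesis using polarization[OF D] that by blast
qed

end

section \<open>The exponential orbit\<close>

context local_algebra
begin

lemma bounded_bilinear_mul: "bounded_bilinear mul"
  unfolding bilinear_conv_bounded_bilinear[symmetric] bilinear_def
  by (auto intro!: linearI simp: mul_add_left mul_add_right mul_scale_left mul_scale_right
      scaleR_eq_scale)

lemma pw_eq_0: "x \<in> M \<Longrightarrow> CARD('m) \<le> k \<Longrightarrow> pw x k = 0"
  using pw_mem_P[of x k] P_eq_0[of k] by simp

lemma aexp_zero: "aexp mul one 0 = one"
proof -
  have "(1 / of_nat (fact k)) *s pw 0 k = (if k = 0 then one else 0)" for k
    by (cases k) simp_all
  then show ?thesis unfolding aexp_def by simp
qed

text \<open>The terms of degree 3 and higher lie in \<open>P 3\<close>; the bound on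
  \<open>CARD('m)\<close> ensures that the truncated sum reaches the quadratic term.\<close>

lemma aexp_quadratic:
  assumes "v \<in> M" "P 3 = {0}" "2 \<le> CARD('m)"
  shows "aexp mul one v = one + v + (1 / 2) *s (v \<odot> v)"
proof -
  have "pw v k = 0" if "k \<ge> 3" for k
    using pw_mem_P[OF assms(1), of k] P_antimono[OF that] assms(2) by auto
  then have "aexp mul one v = (\<Sum>k\<le>2. (1 / of_nat (fact k)) *s pw v k)"
    unfolding aexp_def using assms(3) by (intro sum.mono_neutral_right) auto
  also have "\<dots> = one + v + (1 / 2) *s (v \<odot> v)"
    by (simp add: numeral_2_eq_2)
  finally show ?thesis .
qed

text \<open>The product rule along a real line. For \<open>k = 0\<close> the truncated exponent
  \<open>k - 1\<close> is harmless because the factor \<open>of_nat k\<close> vanishes.\<close>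

lemma has_vector_derivative_pw:
  "((\<lambda>t. pw (w + t *\<^sub>R v) k) has_vector_derivative of_nat k *s (v \<odot> pw w (k - 1))) (at 0)"
proof (induction k)
  case 0
  then show ?case by simp
next
  case (Suc k)
  have "((\<lambda>t. w + t *\<^sub>R v) has_vector_derivative v) (at 0)"
    by (auto intro!: derivative_eq_intros)
  from bounded_bilinear.has_vector_derivative[OF bounded_bilinear_mul this Suc]
  have "((\<lambda>t. pw (w + t *\<^sub>R v) (Suc k)) has_vector_derivative
      w \<odot> (of_nat k *s (v \<odot> pw w (k - 1))) + v \<odot> pw w k) (at 0)"
    by simp
  also have "w \<odot> (of_nat k *s (v \<odot> pw w (k - 1))) = of_nat k *s (v \<odot> pw w k)"
    by (cases k) (simp_all add: mul_scale_right mul_left_commute[of w v] del: of_nat_Suc)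
  also have "\<dots> + v \<odot> pw w k = of_nat (Suc k) *s (v \<odot> pw w (Suc k - 1))"
    by (simp add: vec.scale_left_distrib)
  finally show ?case .
qed

text \<open>Differentiating termwise shifts the finite sum and loses its top term; that term is zero
  because \<open>w\<close> is nilpotent, so the truncated exponential still satisfies the
  differential equation of the full series.\<close>

lemma has_vector_derivative_aexp:
  assumes "w \<in> M"
  shows "((\<lambda>t. aexp mul one (w + t *\<^sub>R v)) has_vector_derivative v \<odot> aexp mul one w) (at 0)"
proof -
  let ?f = "\<lambda>k. (1 / of_nat (fact k)) *s pw w k"
  have scale: "bounded_linear ((*s) c)" for c :: complex
    unfolding linear_conv_bounded_linear[symmetric]
    by (auto intro!: linearI simp: scaleR_eq_scale vec.scale_right_distrib mult.commute)
  have "((\<lambda>t. aexp mul one (w + t *\<^sub>R v)) has_vector_derivative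
      (\<Sum>k\<le>CARD('m). (1 / of_nat (fact k)) *s (of_nat k *s (v \<odot> pw w (k - 1))))) (at 0)"
    unfolding aexp_def
    by (intro has_vector_derivative_sum
        bounded_linear.has_vector_derivative[OF scale] has_vector_derivative_pw)
  also have "(\<Sum>k\<le>CARD('m). (1 / of_nat (fact k)) *s (of_nat k *s (v \<odot> pw w (k - 1))))
      = v \<odot> (\<Sum>k<CARD('m). ?f k)"
  proof -
    obtain N where N: "CARD('m) = Suc N" using zero_less_card_finite by (metis gr0_implies_Suc)
    have "1 / of_nat (fact (Suc k)) * of_nat (Suc k) = (1 / of_nat (fact k) :: complex)" for k
      unfolding fact_Suc of_nat_mult of_nat_id by (simp del: of_nat_Suc)
    then have "(1 / of_nat (fact (Suc k))) *s (of_nat (Suc k) *s (v \<odot> pw w k)) = v \<odot> ?f k" for k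
      unfolding vec.scale_scale by (simp only: mul_scale_right)
    then show ?thesis
      unfolding N sum.atMost_Suc_shift lessThan_Suc_atMost mul_sum_right by simp
  qed
  also have "(\<Sum>k<CARD('m). ?f k) = aexp mul one w"
    unfolding aexp_def lessThan_Suc_atMost[symmetric] sum.lessThan_Suc
    by (simp add: pw_eq_0[OF assms])
  finally show ?thesis .
qed

end

section \<open>Algebras generated by \<open>n\<close> independent elements of the maximal
  ideal\<close>

locale n_factor_algebra = local_algebra mul one
  for mul :: "complex^'m \<Rightarrow> complex^'m \<Rightarrow> complex^'m" (infixl "\<odot>" 70)
    and one :: "complex^'m" +
  fixes n :: nat and s :: "nat \<Rightarrow> complex^'m"
  assumes dim: "CARD('m) = n + 2" and fac: "n_factor mul one n s"
begin

abbreviation V :: "(complex^'m) set" where "V \<equiv> vec.span (s ` {1..n})"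

lemma s_mem_V: "i \<in> {1..n} \<Longrightarrow> s i \<in> V"
  by (simp add: vec.span_base)

lemma V_subset_M: "V \<subseteq> M"
  using fac subspace_M by (intro vec.span_minimal) (auto simp: n_factor_def)

lemma dim_V: "vec.dim V = n"
  using fac unfolding n_factor_def
  by (simp add: vec.dim_eq_card_independent card_image)

lemma V_iff: "v \<in> V \<longleftrightarrow> (\<exists>\<alpha>. v = (\<Sum>i\<in>{1..n}. \<alpha> i *s s i))"
proof
  assume "v \<in> V"
  then obtain u where "v = (\<Sum>x\<in>s ` {1..n}. u x *s x)"
    by (auto simp: vec.span_finite)
  also have "\<dots> = (\<Sum>i\<in>{1..n}. u (s i) *s s i)"
    using fac by (simp add: n_factor_def sum.reindex)
  finally show "\<exists>\<alpha>. v = (\<Sum>i\<in>{1..n}. \<alpha> i *s s i)" by (intro exI[of _ "\<lambda>i. u (s i)"])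
next
  assume "\<exists>\<alpha>. v = (\<Sum>i\<in>{1..n}. \<alpha> i *s s i)"
  then show "v \<in> V" by (elim exE, simp only:) (intro vec.span_sum vec.span_scale s_mem_V)
qed

text \<open>The algebra is spanned by monomials, and each monomial arises from \<open>one\<close> by
  repeated multiplication with generators.\<close>

lemma generated_induct:
  assumes T: "vec.subspace T" "one \<in> T"
    and step: "\<And>i x. i \<in> {1..n} \<Longrightarrow> x \<in> T \<Longrightarrow> s i \<odot> x \<in> T"
  shows "x \<in> T"
proof -
  have pw_step: "pw (s i) k \<odot> x \<in> T" if "i \<in> {1..n}" "x \<in> T" for i k x
    by (induction k) (simp_all add: that mul_assoc step[OF that(1)])
  have "foldr mul (map (\<lambda>i. pw (s i) (k i)) is) one \<in> T" if "set is \<subseteq> {1..n}" for k "is"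
    using that by (induction "is") (simp_all add: T(2) pw_step)
  from this[of "[1..<n+1]"] have "range (monomial mul one n s) \<subseteq> T"
    unfolding monomial_def by (intro image_subsetI) (simp add: subset_eq del: upt_Suc)
  then have "polys mul one n s \<subseteq> T"
    unfolding polys_def using T(1) by (intro vec.span_minimal)
  then show ?thesis using fac by (auto simp: n_factor_def)
qed

text \<open>Without generators the algebra would be the line through \<open>one\<close>, whereas its
  dimension is \<open>n + 2\<close>.\<close>

lemma n_pos: "0 < n"
proof (rule ccontr)
  assume "\<not> 0 < n"
  then have "UNIV \<subseteq> vec.span {one}"
    using generated_induct[of "vec.span {one}"] vec.span_base[of one "{one}"] by auto
  then have "vec.dim (UNIV :: (complex^'m) set) \<le> card {one}"
    by (intro vec.dim_le_card) auto
  then show False using dim by (simp add: card_cart_basis)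
qed

lemma orbit_cone_eq: "orbit_cone mul one n s = {c *s aexp mul one v | c v. c \<noteq> 0 \<and> v \<in> V}"
  unfolding orbit_cone_def rho_def V_iff mul_one by blast

lemma orbit_coneI: "c \<noteq> 0 \<Longrightarrow> v \<in> V \<Longrightarrow> c *s aexp mul one v \<in> orbit_cone mul one n s"
  unfolding orbit_cone_eq by blast

text \<open>The basis-free content of \<open>B0\<close>: up to sign, \<open>one\<close> and
  \<open>e\<close> are a hyperbolic pair orthogonal to \<open>V\<close>, and on \<open>V\<close> the
  form is the coefficient of the product along \<open>e\<close>. The closure is computed from these
  properties alone, with \<open>e\<close> playing the part of \<mu>\<open>(n + 2)\<close>.\<close>

definition adapted_form :: "(complex^'m \<Rightarrow> complex^'m \<Rightarrow> complex) \<Rightarrow> complex^'m \<Rightarrow> bool" where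
  "adapted_form Q e \<longleftrightarrow> sym_cbilinear Q \<and> Q one one = 0 \<and> Q one e = -1 \<and> Q e e = 0 \<and>
     (\<forall>v\<in>V. Q one v = 0 \<and> Q v e = 0) \<and> (\<forall>v\<in>V. \<forall>w\<in>V. v \<odot> w = Q v w *s e)"

abbreviation frame :: "complex^'m \<Rightarrow> (complex^'m) set" where
  "frame e \<equiv> insert one (insert e (s ` {1..n}))"

lemma frame_decomposition:
  assumes "vec.span (frame e) = UNIV"
  obtains a v b where "v \<in> V" "u = a *s one + v + b *s e"
proof -
  have "u \<in> vec.span (frame e)" using assms by simp
  then obtain a b where "u - a *s one - b *s e \<in> V"
    unfolding vec.span_breakdown_eq by blast
  then show ?thesis by (rule that[of _ a b]) (simp add: algebra_simps)
qed

text \<open>By Nakayama \<open>P 3\<close> is strictly smaller than the line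
  \<open>P 2\<close>.\<close>

lemma P_3_eq_0:
  assumes "P 2 = vec.span {e}" "e \<noteq> 0"
  shows "P 3 = {0}"
proof -
  have "P 2 \<noteq> {0}" using assms vec.span_base[of e "{e}"] by auto
  from is_ideal_strict_dim[OF is_ideal_P is_ideal_P P_Suc_psubset[OF this]]
  have "vec.dim (P 3) < vec.dim (P 2)" by (simp add: numeral_3_eq_3 numeral_2_eq_2)
  also have "vec.dim (P 2) = 1" using assms by (simp add: vec.dim_span)
  finally have "P 3 \<subseteq> {0}" by (simp add: vec.dim_eq_0)
  then show ?thesis using vec.subspace_0[OF subspace_P[of 3]] by auto
qed

text \<open>If \<open>Q\<close> vanished on \<open>V\<close>, polarization would make the nonzero
  vector \<open>s 1\<close> orthogonal to \<open>V\<close>, and it is orthogonal to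
  \<open>one\<close> and \<open>e\<close> anyway. The vector \<open>w\<close> serves to perturb
  points of the quadric that lie off the orbit.\<close>

lemma ex_nonisotropic:
  assumes Q: "adapted_form Q e" and nondeg: "nondegenerate Q"
    and span: "vec.span (frame e) = UNIV"
  obtains w where "w \<in> V" "Q w w \<noteq> 0"
proof (rule ccontr)
  assume "\<not> thesis"
  with that have zero: "Q w w = 0" if "w \<in> V" for w using that by blast
  interpret Q: symmetric_form Q using Q by unfold_locales (simp add: adapted_form_def)
  have QV: "Q v w = 0" if "v \<in> V" "w \<in> V" for v w
    using zero[of "v + w"] zero[of v] zero[of w] that
    by (simp add: vec.span_add Q.bilinear_simps Q.commute[of w v])
  have "s 1 \<in> V" using n_pos by (intro s_mem_V) simp
  have "Q (s 1) u = 0" for u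
    using span
  proof (rule frame_decomposition)
    fix a v b assume "v \<in> V" "u = a *s one + v + b *s e"
    then show ?thesis
      using Q \<open>s 1 \<in> V\<close> Q.commute[of "s 1" one]
      by (simp add: adapted_form_def Q.bilinear_simps QV del: One_nat_def)
  qed
  then have "s 1 = 0" using nondeg by (simp add: nondegenerate_def)
  then have "0 \<in> s ` {1..n}" using n_pos by force
  then show False using fac vec.dependent_zero by (auto simp: n_factor_def)
qed

lemma closure_orbit_cone_eq:
  assumes Q: "adapted_form Q e" and nondeg: "nondegenerate Q"
    and P2: "P 2 = vec.span {e}" and e: "e \<noteq> 0" and span: "vec.span (frame e) = UNIV"
  shows "closure (orbit_cone mul one n s) = {u. Q u u = 0}"
proof
  interpret Q: symmetric_form Q using Q by unfold_locales (simp add: adapted_form_def)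
  have Q1: "Q one one = 0" "Q one e = -1" "Q e one = -1" "Q e e = 0"
    and QV: "\<And>v. v \<in> V \<Longrightarrow> Q one v = 0" "\<And>v. v \<in> V \<Longrightarrow> Q v one = 0"
      "\<And>v. v \<in> V \<Longrightarrow> Q v e = 0" "\<And>v. v \<in> V \<Longrightarrow> Q e v = 0"
    and mulV: "\<And>v w. v \<in> V \<Longrightarrow> w \<in> V \<Longrightarrow> v \<odot> w = Q v w *s e"
    using Q Q.commute by (auto simp: adapted_form_def)
  have quad: "Q (a *s one + v + b *s e) (a *s one + v + b *s e) = Q v v - 2 * a * b"
    if "v \<in> V" for a v b
    using that by (simp add: Q.bilinear_simps Q1 QV)
  have exp: "aexp mul one v = one + v + (Q v v / 2) *s e" if "v \<in> V" for v
    using aexp_quadratic[of v] P_3_eq_0[OF P2 e] V_subset_M that dim by (auto simp: mulV)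
  \<comment> \<open>The vector \<open>(1 / a) *s v\<close> is the right exponent: the
    \<open>e\<close>-coordinate of its exponential is
    \<open>Q v v / (2 * a^2) = b / a\<close>.\<close>
  have affine: "a *s one + v + b *s e \<in> orbit_cone mul one n s"
    if "a \<noteq> 0" "v \<in> V" "Q v v = 2 * a * b" for a v b
  proof -
    have w: "(1 / a) *s v \<in> V" using that(2) by (rule vec.span_scale)
    have "Q ((1 / a) *s v) ((1 / a) *s v) / 2 = b / a"
      using that by (simp add: Q.bilinear_simps)
    then have "a *s aexp mul one ((1 / a) *s v) = a *s one + v + b *s e"
      using that(1) by (simp add: exp[OF w] vec.scale_right_distrib)
    then show ?thesis using orbit_coneI[OF that(1) w] by simp
  qed
  show "closure (orbit_cone mul one n s) \<subseteq> {u. Q u u = 0}"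
  proof (rule closure_minimal)
    show "orbit_cone mul one n s \<subseteq> {u. Q u u = 0}"
    proof
      fix u assume "u \<in> orbit_cone mul one n s"
      then obtain c v where v: "v \<in> V" and u: "u = c *s aexp mul one v"
        unfolding orbit_cone_eq by blast
      have "Q (aexp mul one v) (aexp mul one v) = 0"
        using quad[OF v, of 1 "Q v v / 2"] unfolding exp[OF v] by simp
      then show "u \<in> {u. Q u u = 0}" by (simp add: u Q.scale_left Q.scale_right)
    qed
  qed (rule Q.closed_isotropic)
  show "{u. Q u u = 0} \<subseteq> closure (orbit_cone mul one n s)"
  proof
    fix u assume "u \<in> {u. Q u u = 0}"
    then have u0: "Q u u = 0" by simp
    obtain a v b where v: "v \<in> V" and u: "u = a *s one + v + b *s e"
      using span by (rule frame_decomposition)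
    have ab: "Q v v = 2 * a * b" using u0 quad[OF v] by (simp add: u)
    consider "a \<noteq> 0" | "a = 0" "b = 0" | "a = 0" "b \<noteq> 0" by blast
    then show "u \<in> closure (orbit_cone mul one n s)"
    proof cases
      case 1
      then show ?thesis using affine[OF _ v ab] closure_subset u by blast
    next
      case 2
      \<comment> \<open>Here \<open>Q v v = 0\<close>, so a small coordinate along
        \<open>one\<close> may be added without leaving the quadric as long as the
        \<open>e\<close>-coordinate stays zero.\<close>
      define f where "f k = inverse (real (Suc k)) *\<^sub>R one + v" for k
      have "f k \<in> orbit_cone mul one n s" for k
        using affine[of "complex_of_real (inverse (real (Suc k)))" v 0] v ab 2
        by (simp add: f_def scaleR_eq_scale del: of_nat_Suc)
      moreover have "f \<longlonglongrightarrow> 0 *\<^sub>R one + v"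
        unfolding f_def by (intro tendsto_intros LIMSEQ_inverse_real_of_nat)
      ultimately show ?thesis
        unfolding closure_sequential using 2 by (intro exI[of _ f]) (simp add: u)
    next
      case 3
      obtain w where w: "w \<in> V" "Q w w \<noteq> 0" using ex_nonisotropic[OF Q nondeg span] .
      text \<open>The scaling of \<open>w\<close> makes \<open>Q\<close> nonzero at \<open>v + t w\<close> for every \<open>t > 0\<close>.\<close>
      define w' where "w' = (if Q v w = 0 then 1 else Q v w / Q w w) *s w"
      have w': "w' \<in> V" using w(1) by (simp add: w'_def vec.span_scale)
      have Qt: "Q (v + t *\<^sub>R w') (v + t *\<^sub>R w') = t * (2 * Q v w' + t * Q w' w')" for t
        using ab 3 Q.commute[of w' v]
        by (simp add: scaleR_eq_scale Q.bilinear_simps algebra_simps)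
      have Qt_neq: "Q (v + t *\<^sub>R w') (v + t *\<^sub>R w') \<noteq> 0" if "t > 0" for t
      proof (cases "Q v w = 0")
        case True
        then show ?thesis
          using that w(2) unfolding Qt by (simp add: w'_def)
      next
        case False
        have "2 * Q v w' + t * Q w' w' = (2 + complex_of_real t) * (Q v w * Q v w / Q w w)"
          using False w(2) by (simp add: w'_def Q.bilinear_simps field_simps)
        moreover have "2 + complex_of_real t \<noteq> 0"
          using that by (simp add: complex_eq_iff)
        ultimately show ?thesis using that False w(2) by (simp add: Qt)
      qed
      \<comment> \<open>With \<open>b\<close> fixed and nonzero, the equation of the quadric
        determines the coordinate along \<open>one\<close>; it is nonzero as soon as the perturbed
        \<open>v\<close> is not isotropic.\<close>
      define g where
        "g t = (Q (v + t *\<^sub>R w') (v + t *\<^sub>R w') / (2 * b)) *s one + (v + t *\<^sub>R w') + b *s e" for t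
      have "g t \<in> orbit_cone mul one n s" if "t > 0" for t
        unfolding g_def
      proof (rule affine)
        show "v + t *\<^sub>R w' \<in> V"
          using v w' by (simp add: scaleR_eq_scale vec.span_add vec.span_scale)
      qed (use Qt_neq[OF that] 3 in auto)
      then have "g (inverse (real (Suc k))) \<in> orbit_cone mul one n s" for k
        by simp
      moreover have "(\<lambda>k. g (inverse (real (Suc k)))) \<longlonglongrightarrow> g 0"
      proof (rule tendsto_compose[OF _ LIMSEQ_inverse_real_of_nat])
        have scale: "bounded_linear (\<lambda>c. c *s one)"
          unfolding linear_conv_bounded_linear[symmetric]
          by (auto intro!: linearI simp: scaleR_eq_scale scaleR_conv_of_real vec.scale_left_distrib)
        show "g \<midarrow>0\<rightarrow> g 0"
          unfolding g_def Qt
          by (intro tendsto_intros bounded_linear.tendsto[OF scale]) (use 3 in auto)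
      qed
      moreover have "g 0 = u" using 3 ab by (simp add: g_def u)
      ultimately show ?thesis
        unfolding closure_sequential by (intro exI[of _ "\<lambda>k. g (inverse (real (Suc k)))"]) simp
    qed
  qed
qed

subsection \<open>The form \<open>B\<^sub>0\<close> of a proper basis\<close>

lemma frame_eq_image:
  assumes "\<mu> 1 = one" and s: "\<forall>i\<in>{1..n}. \<mu> (i + 1) = s i"
  shows "\<mu> ` {1..n+2} = frame (\<mu> (n + 2))" "\<mu> ` {2..n+2} = insert (\<mu> (n + 2)) (s ` {1..n})"
proof -
  have mid: "\<mu> ` (\<lambda>i. i + 1) ` {1..n} = s ` {1..n}"
    unfolding image_image by (intro image_cong refl bspec[OF s])
  have "{2..n+2} = insert (n + 2) ((\<lambda>i. i + 1) ` {1..n})"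
    by (auto simp: image_iff)
  then show top: "\<mu> ` {2..n+2} = insert (\<mu> (n + 2)) (s ` {1..n})"
    using mid by (metis image_insert)
  have "{1..n+2} = insert 1 {2..n+2}" by auto
  then show "\<mu> ` {1..n+2} = frame (\<mu> (n + 2))"
    using top assms(1) by (metis image_insert)
qed

context
  fixes \<mu> :: "nat \<Rightarrow> complex^'m"
  assumes basis: "proper_basis mul one n s \<mu>"
    and P2: "P 2 = vec.span {\<mu> (n + 2)}"
begin

lemma mu_values: "\<mu> 1 = one" "i \<in> {1..n} \<Longrightarrow> \<mu> (i + 1) = s i"
  using basis unfolding proper_basis_def by blast+

lemma mu_image: "\<mu> ` {1..n+2} = frame (\<mu> (n + 2))"
  using frame_eq_image[of \<mu>] mu_values by blast

lemma frame_span: "vec.span (frame (\<mu> (n + 2))) = UNIV"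
  using basis unfolding mu_image[symmetric] proper_basis_def by blast

lemma mu_last_neq_0: "\<mu> (n + 2) \<noteq> 0"
proof
  assume "\<mu> (n + 2) = 0"
  then have "0 \<in> \<mu> ` {1..n+2}" by (intro image_eqI[of _ _ "n + 2"]) simp_all
  then show False using basis vec.dependent_zero unfolding proper_basis_def by blast
qed

lemma coord_basis:
  assumes "k \<in> {1..n+2}" "i \<in> {1..n+2}"
  shows "coord n \<mu> (\<mu> k) i = (if i = k then 1 else 0)"
proof -
  have "vec.independent (\<mu> ` {1..n+2})" "inj_on \<mu> {1..n+2}"
    using basis unfolding proper_basis_def by blast+
  then show ?thesis
    using assms unfolding coord_def
    by (simp add: vec.representation_basis inj_on_eq_iff)
qed

lemma B0_on_basis:
  assumes "k \<in> {1..n+2}" "l \<in> {1..n+2}"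
  shows "B0 mul n \<mu> (\<mu> k) (\<mu> l) = B0_basis mul n \<mu> k l"
proof -
  have "B0 mul n \<mu> (\<mu> k) (\<mu> l) = (\<Sum>i\<in>{1..n+2}. \<Sum>j\<in>{1..n+2}.
      if i = k then if j = l then B0_basis mul n \<mu> k l else 0 else 0)"
    unfolding B0_def
    by (intro sum.cong refl) (use assms in \<open>auto simp: coord_basis simp del: atLeastAtMost_iff\<close>)
  also have "\<dots> = (\<Sum>i\<in>{1..n+2}. if i = k then B0_basis mul n \<mu> k l else 0)"
    using assms by (intro sum.cong refl) (simp add: sum.delta)
  finally show ?thesis using assms by (simp add: sum.delta)
qed

lemma struct_a_commute: "struct_a mul n \<mu> i j = struct_a mul n \<mu> j i"
  unfolding struct_a_def by (simp add: mul_commute)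

lemma sym_cbilinear_B0: "sym_cbilinear (B0 mul n \<mu>)"
proof -
  have rep: "vec.independent (\<mu> ` {1..n+2})" "\<And>x. x \<in> vec.span (\<mu> ` {1..n+2})"
    using basis unfolding proper_basis_def by auto
  have coord_add: "coord n \<mu> (x + y) i = coord n \<mu> x i + coord n \<mu> y i" for x y i
    unfolding coord_def vec.representation_add[OF rep(1) rep(2) rep(2)] by simp
  have coord_scale: "coord n \<mu> (c *s x) i = c * coord n \<mu> x i" for c x i
    unfolding coord_def vec.representation_scale[OF rep(1) rep(2)] by simp
  have comm: "B0_basis mul n \<mu> i j = B0_basis mul n \<mu> j i" for i j
    by (simp add: B0_basis_def struct_a_commute[of i j])
  have "B0 mul n \<mu> x y = B0 mul n \<mu> y x" for x y
    unfolding B0_def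
    by (subst sum.swap, intro sum.cong refl) (simp add: comm mult.commute)
  then show ?thesis
    unfolding sym_cbilinear_def
    by (simp add: B0_def coord_add coord_scale ring_distribs sum.distrib sum_distrib_left mult.assoc)
qed

text \<open>The product lies in \<open>P 2\<close>, a line with nonzero generator, so its
  coefficient exists and is unique and the \<open>THE\<close> in \<open>struct_a\<close> is well
  defined.\<close>

lemma mul_s_s_eq:
  assumes ij: "i \<in> {1..n}" "j \<in> {1..n}"
  shows "s i \<odot> s j = struct_a mul n \<mu> (i + 1) (j + 1) *s \<mu> (n + 2)"
proof -
  have "s i \<in> M" "s j \<in> M" using ij s_mem_V V_subset_M by blast+
  then have "s i \<odot> s j \<in> P 2"
    using mul_mem_P[of "s i" "s j" "Suc 0"] P_1 by (simp add: numeral_2_eq_2)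
  then obtain a where a: "s i \<odot> s j = a *s \<mu> (n + 2)"
    unfolding P2 vec.span_singleton by auto
  have "struct_a mul n \<mu> (i + 1) (j + 1) = a"
    unfolding struct_a_def mu_values(2)[OF ij(1)] mu_values(2)[OF ij(2)] a
    using mu_last_neq_0 by (intro the_equality) auto
  then show ?thesis using a by simp
qed

text \<open>The table \<open>B0_basis\<close> gives the identities on basis vectors, and linearity
  extends them to \<open>V\<close> one argument at a time.\<close>

lemma adapted_form_B0: "adapted_form (B0 mul n \<mu>) (\<mu> (n + 2))"
proof -
  interpret Q: symmetric_form "B0 mul n \<mu>" by unfold_locales (rule sym_cbilinear_B0)
  have val: "B0 mul n \<mu> (\<mu> k) (\<mu> l) = B0_basis mul n \<mu> k l" if "k \<in> {1..n+2}" "l \<in> {1..n+2}" for k l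
    using that by (rule B0_on_basis)
  have one: "B0 mul n \<mu> one (s i) = 0" and last: "B0 mul n \<mu> (s i) (\<mu> (n + 2)) = 0"
    and gen: "j \<in> {1..n} \<Longrightarrow> s i \<odot> s j = B0 mul n \<mu> (s i) (s j) *s \<mu> (n + 2)"
    if "i \<in> {1..n}" for i j
    using that val[of 1 "i + 1"] val[of "i + 1" "n + 2"] val[of "i + 1" "j + 1"]
      mu_values(1) mu_values(2)[of i] mu_values(2)[of j] mul_s_s_eq[of i j]
    by (simp_all add: B0_basis_def)
  have oneV: "B0 mul n \<mu> one v = 0" and lastV: "B0 mul n \<mu> v (\<mu> (n + 2)) = 0" if "v \<in> V" for v
    using that
    by (induction rule: vec.span_induct_alt) (auto simp: Q.bilinear_simps one last[simplified])
  have genV: "s i \<odot> w = B0 mul n \<mu> (s i) w *s \<mu> (n + 2)"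
    if "i \<in> {1..n}" "w \<in> V" for i w
    using that(2)
    by (induction rule: vec.span_induct_alt)
      (auto simp: gen[OF that(1)] Q.bilinear_simps mul_add_right mul_scale_right vec.scale_left_distrib
        simp del: atLeastAtMost_iff)
  have "v \<odot> w = B0 mul n \<mu> v w *s \<mu> (n + 2)" if "v \<in> V" "w \<in> V" for v w
    using that(1)
    by (induction rule: vec.span_induct_alt)
      (auto simp: genV[OF _ that(2)] Q.bilinear_simps mul_add_left mul_scale_left vec.scale_left_distrib
        simp del: atLeastAtMost_iff)
  moreover have "B0 mul n \<mu> one one = 0" "B0 mul n \<mu> one (\<mu> (n + 2)) = -1"
      "B0 mul n \<mu> (\<mu> (n + 2)) (\<mu> (n + 2)) = 0"
    using val[of 1 1] val[of 1 "n + 2"] val[of "n + 2" "n + 2"] mu_values(1)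
    by (simp_all add: B0_basis_def)
  ultimately show ?thesis
    unfolding adapted_form_def using sym_cbilinear_B0 oneV lastV by blast
qed

end

end

section \<open>Orbit closures that are quadrics\<close>

locale quadric_orbit_closure =
  n_factor_algebra mul one n s + symmetric_form B
  for mul :: "complex^'m \<Rightarrow> complex^'m \<Rightarrow> complex^'m" (infixl "\<odot>" 70)
    and one :: "complex^'m" and n :: nat and s :: "nat \<Rightarrow> complex^'m"
    and B :: "complex^'m \<Rightarrow> complex^'m \<Rightarrow> complex" +
  assumes nondeg: "nondegenerate B"
    and closure_eq: "closure (orbit_cone mul one n s) = {u. B u u = 0}"
begin

lemma eq_0_if_orthogonal: "(\<And>y. B x y = 0) \<Longrightarrow> x = 0"
  using nondeg unfolding nondegenerate_def by blast

lemma aexp_isotropic: "v \<in> V \<Longrightarrow> B (aexp mul one v) (aexp mul one v) = 0"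
proof -
  assume "v \<in> V"
  then have "1 *s aexp mul one v \<in> orbit_cone mul one n s"
    by (intro orbit_coneI) simp_all
  then show ?thesis using closure_subset closure_eq by auto
qed

lemma one_isotropic: "B one one = 0"
  using aexp_isotropic[of 0] by (simp add: aexp_zero vec.span_zero)

lemma one_neq_0: "one \<noteq> 0"
  using one_notin_M subspace_M vec.subspace_0 by blast

text \<open>Differentiate \<open>B (exp (w + t v)) (exp (w + t v)) = 0\<close> at \<open>t = 0\<close>.\<close>
lemma tangent_orthogonal:
  assumes "v \<in> V" "w \<in> V"
  shows "B (v \<odot> aexp mul one w) (aexp mul one w) = 0"
proof -
  let ?E = "\<lambda>t. aexp mul one (w + t *\<^sub>R v)"
  have "w \<in> M" using assms(2) V_subset_M by blast
  note E' = has_vector_derivative_aexp[OF this, of v]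
  have "((\<lambda>t. B (?E t) (?E t)) has_vector_derivative
      B (?E 0) (v \<odot> aexp mul one w) + B (v \<odot> aexp mul one w) (?E 0)) (at 0)"
    by (rule bounded_bilinear.has_vector_derivative[OF bounded_bilinear E' E'])
  moreover have "B (?E t) (?E t) = 0" for t
    using assms by (intro aexp_isotropic) (simp add: scaleR_eq_scale vec.span_add vec.span_scale)
  ultimately have "((\<lambda>t::real. 0) has_vector_derivative
      2 * B (v \<odot> aexp mul one w) (aexp mul one w)) (at 0)"
    by (simp add: commute[of "aexp mul one w"])
  from vector_derivative_unique_at[OF this has_vector_derivative_const] show ?thesis by simp
qed

lemma V_pw_eq_0: "v \<in> V \<Longrightarrow> pw v (CARD('m)) = 0"
  using V_subset_M pw_eq_0 by blast

lemma V_skew: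
  assumes v: "v \<in> V"
  shows "B (v \<odot> x) y = - B x (v \<odot> y)"
proof -
  define D where "D = (\<lambda>x y. B (v \<odot> x) y + B x (v \<odot> y))"
  have D: "sym_cbilinear D"
    unfolding sym_cbilinear_def D_def
    by (auto simp: bilinear_simps mul_add_right mul_scale_right ring_distribs commute[of "v \<odot> _"])
  then interpret D: symmetric_form D by unfold_locales
  have "orbit_cone mul one n s \<subseteq> {u. D u u = 0}"
  proof
    fix u assume "u \<in> orbit_cone mul one n s"
    then obtain c w where w: "w \<in> V" and u: "u = c *s aexp mul one w"
      unfolding orbit_cone_eq by blast
    have "D (aexp mul one w) (aexp mul one w) = 0"
      using tangent_orthogonal[OF v w] commute[of "aexp mul one w"] by (simp add: D_def)
    then show "u \<in> {u. D u u = 0}" by (simp add: u D.scale_left D.scale_right)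
  qed
  then have "closure (orbit_cone mul one n s) \<subseteq> {u. D u u = 0}"
    by (rule closure_minimal) (rule D.closed_isotropic)
  then have "D u u = 0" if "B u u = 0" for u
    using that closure_eq by auto
  then obtain c where c: "\<And>x y. D x y = c * B x y"
    using proportional_if_isotropic_subset[OF nondeg one_neq_0 one_isotropic D] by blast
  \<comment> \<open>If \<open>v\<close> kills \<open>x\<close>, moving \<open>v\<close> across the
    form \<open>k\<close> times gives \<open>c ^ k * B x y = B x (pw v k \<odot> y)\<close>, which
    vanishes for large \<open>k\<close>. So a nonzero \<open>c\<close> would make multiplication by
    \<open>v\<close> injective, contrary to nilpotency.\<close>
  have "c = 0"
  proof (rule ccontr)
    assume "c \<noteq> 0"
    have kernel: "x = 0" if "v \<odot> x = 0" for x
    proof (rule eq_0_if_orthogonal)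
      fix y
      have shift: "c * B x z = B x (v \<odot> z)" for z
        using c[of x z] that by (simp add: D_def)
      have "c ^ k * B x y = B x (pw v k \<odot> y)" for k
        by (induction k) (simp_all add: shift[symmetric] mul_assoc mult.assoc)
      from this[of "CARD('m)"] show "B x y = 0"
        using \<open>c \<noteq> 0\<close> V_pw_eq_0[OF v] by simp
    qed
    have "pw v k \<noteq> 0" for k
      using kernel one_neq_0 by (induction k) auto
    then show False using V_pw_eq_0[OF v] by blast
  qed
  then show ?thesis using c[of x y] by (simp add: D_def add_eq_0_iff)
qed

section \<open>Skew and self-adjoint elements of the maximal ideal\<close>

definition skew :: "(complex^'m) set" where
  "skew = {a \<in> M. \<forall>x y. B (a \<odot> x) y = - B x (a \<odot> y)}"

text \<open>The restriction to \<open>M\<close> excludes \<open>one\<close>, which acts as the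
  identity and is also self-adjoint.\<close>

definition selfadjoint :: "(complex^'m) set" where
  "selfadjoint = {a \<in> M. \<forall>x y. B (a \<odot> x) y = B x (a \<odot> y)}"

lemma V_subset_skew: "V \<subseteq> skew"
  unfolding skew_def using V_subset_M V_skew by blast

lemma subspace_skew: "vec.subspace skew"
  using subspace_M unfolding vec.subspace_def skew_def
  by (simp add: mul_add_left mul_scale_left bilinear_simps)

lemma subspace_selfadjoint: "vec.subspace selfadjoint"
  using subspace_M unfolding vec.subspace_def selfadjoint_def
  by (simp add: mul_add_left mul_scale_left bilinear_simps)

lemma skew_mul_skew: "a \<in> skew \<Longrightarrow> b \<in> skew \<Longrightarrow> a \<odot> b \<in> selfadjoint"
  unfolding skew_def selfadjoint_def
  by (simp add: mul_mem_M mul_assoc mul_left_commute[of b a])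

lemma skew_mul_selfadjoint: "a \<in> skew \<Longrightarrow> b \<in> selfadjoint \<Longrightarrow> a \<odot> b \<in> skew"
  unfolding skew_def selfadjoint_def
  by (simp add: mul_mem_M mul_assoc mul_left_commute[of b a])

lemma selfadjoint_mul_selfadjoint:
  "a \<in> selfadjoint \<Longrightarrow> b \<in> selfadjoint \<Longrightarrow> a \<odot> b \<in> selfadjoint"
  unfolding selfadjoint_def
  by (simp add: mul_mem_M mul_assoc mul_left_commute[of b a])

lemma skew_Int_selfadjoint:
  assumes "a \<in> skew" "a \<in> selfadjoint"
  shows "a = 0"
proof (rule eq_0_if_orthogonal)
  fix y
  have "B (a \<odot> one) y = - B one (a \<odot> y)" "B (a \<odot> one) y = B one (a \<odot> y)"
    using assms unfolding skew_def selfadjoint_def by blast+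
  then show "B a y = 0" by simp
qed

lemma B_one_skew: "a \<in> skew \<Longrightarrow> B one a = 0"
proof -
  assume "a \<in> skew"
  then have "B (a \<odot> one) one = - B one (a \<odot> one)" unfolding skew_def by blast
  then show ?thesis by (simp add: commute[of a one])
qed

text \<open>Multiplication by the skew element \<open>s i\<close> exchanges skew and self-adjoint
  elements and sends \<open>one\<close> to a skew one, so the sums of this shape are stable under
  all generators.\<close>

lemma decomposition:
  obtains c a b where "a \<in> skew" "b \<in> selfadjoint" "x = c *s one + a + b"
proof -
  let ?T = "{c *s one + a + b | c a b. a \<in> skew \<and> b \<in> selfadjoint}"
  have TI: "c *s one + a + b \<in> ?T" if "a \<in> skew" "b \<in> selfadjoint" for c a b
    using that by blast
  note zeros = vec.subspace_0[OF subspace_skew] vec.subspace_0[OF subspace_selfadjoint]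
  have "x \<in> ?T"
  proof (rule generated_induct)
    show "vec.subspace ?T"
    proof (rule vec.subspaceI)
      show "0 \<in> ?T" using TI[OF zeros, of 0] by simp
    next
      fix x y assume "x \<in> ?T" "y \<in> ?T"
      then obtain c a b c' a' b' where eq: "x = c *s one + a + b" "y = c' *s one + a' + b'"
        and mem: "a \<in> skew" "a' \<in> skew" "b \<in> selfadjoint" "b' \<in> selfadjoint" by blast
      have "x + y = (c + c') *s one + (a + a') + (b + b')"
        by (simp add: eq vec.scale_left_distrib)
      then show "x + y \<in> ?T"
        using TI[of "a + a'" "b + b'" "c + c'"] mem subspace_skew subspace_selfadjoint
        by (metis vec.subspace_add)
    next
      fix d x assume "x \<in> ?T"
      then obtain c a b where eq: "x = c *s one + a + b" and mem: "a \<in> skew" "b \<in> selfadjoint"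
        by blast
      have "d *s x = (d * c) *s one + d *s a + d *s b"
        by (simp add: eq vec.scale_right_distrib)
      then show "d *s x \<in> ?T"
        using TI[of "d *s a" "d *s b" "d * c"] mem subspace_skew subspace_selfadjoint
        by (metis vec.subspace_scale)
    qed
    show "one \<in> ?T" using TI[OF zeros, of 1] by simp
  next
    fix i x assume "i \<in> {1..n}" "x \<in> ?T"
    then obtain c a b where eq: "x = c *s one + a + b" and mem: "a \<in> skew" "b \<in> selfadjoint"
      by blast
    have si: "s i \<in> skew" using \<open>i \<in> {1..n}\<close> s_mem_V V_subset_skew by blast
    have "s i \<odot> x = 0 *s one + (c *s s i + s i \<odot> b) + s i \<odot> a"
      by (simp add: eq mul_add_right mul_scale_right)
    moreover have "c *s s i + s i \<odot> b \<in> skew" "s i \<odot> a \<in> selfadjoint"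
      using si mem subspace_skew
      by (simp_all add: vec.subspace_add vec.subspace_scale skew_mul_selfadjoint skew_mul_skew)
    ultimately show "s i \<odot> x \<in> ?T"
      using TI[of "c *s s i + s i \<odot> b" "s i \<odot> a" 0] by (simp only:)
  qed
  then show ?thesis using that by blast
qed

lemma M_decomposition:
  assumes "x \<in> M"
  obtains a b where "a \<in> skew" "b \<in> selfadjoint" "x = a + b"
proof -
  obtain c a b where ab: "a \<in> skew" "b \<in> selfadjoint" and x: "x = c *s one + a + b"
    by (rule decomposition)
  have "c *s one = x - a - b" by (simp add: x)
  also have "\<dots> \<in> M"
    using assms ab subspace_M by (auto simp: skew_def selfadjoint_def intro!: vec.subspace_diff)
  finally have "c *s one \<in> M" .
  have "c = 0"
  proof (rule ccontr)
    assume "c \<noteq> 0"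
    then have "one = (1 / c) *s (c *s one)" by simp
    then show False
      using \<open>c *s one \<in> M\<close> one_notin_M subspace_M by (metis vec.subspace_scale)
  qed
  then show ?thesis using that[OF ab] x by simp
qed

text \<open>By nondegeneracy the functional \<open>B one\<close> is nonzero; it kills
  \<open>one\<close> and all skew elements, so it must be seen on a self-adjoint one.\<close>

lemma B_one_nonzero:
  obtains e where "e \<in> selfadjoint" "B one e \<noteq> 0"
proof -
  obtain y where "B one y \<noteq> 0" using one_neq_0 eq_0_if_orthogonal by blast
  moreover obtain c a b where "a \<in> skew" and b: "b \<in> selfadjoint" and "y = c *s one + a + b"
    by (rule decomposition)
  ultimately have "B one b \<noteq> 0" by (simp add: bilinear_simps one_isotropic B_one_skew)
  with b show ?thesis by (rule that)
qed

text \<open>A dimension count: the kernel of \<open>B one\<close> on \<open>M\<close> contains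
  \<open>V\<close> and is strictly smaller than \<open>M\<close>, whose dimension is
  \<open>n + 1\<close>.\<close>

lemma V_eq: "V = {x \<in> M. B one x = 0}"
proof -
  let ?K = "{x \<in> M. B one x = 0}"
  have K: "vec.subspace ?K"
    using subspace_M unfolding vec.subspace_def by (simp add: bilinear_simps)
  have VK: "V \<subseteq> ?K" using V_subset_M V_subset_skew B_one_skew by blast
  obtain e where "e \<in> selfadjoint" "B one e \<noteq> 0" by (rule B_one_nonzero)
  then have "?K \<subset> M" unfolding selfadjoint_def by blast
  then have "vec.dim ?K < vec.dim M"
    using K subspace_M vec.dim_psubset[of ?K M] vec.span_eq_iff by metis
  then have "vec.dim ?K \<le> vec.dim V" using dim_M dim dim_V by simp
  from vec.dim_eq_span[OF VK this] show ?thesis using K by (simp add: vec.span_span)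
qed

lemma skew_eq_V: "skew = V"
  using V_subset_skew B_one_skew unfolding V_eq skew_def by blast

lemma M_structure:
  obtains e where "e \<in> selfadjoint" "B one e \<noteq> 0" "P 2 = vec.span {e}" "M = vec.span (insert e (s ` {1..n}))"
    "\<And>v. v \<in> V \<Longrightarrow> v \<odot> e = 0" "e \<odot> e = 0"
proof -
  obtain e where e: "e \<in> selfadjoint" "B one e \<noteq> 0" by (rule B_one_nonzero)
  have e0: "e \<noteq> 0" using e(2) by auto
  have eM: "e \<in> M" using e(1) by (simp add: selfadjoint_def)
  \<comment> \<open>Removing the multiple of \<open>e\<close> seen by \<open>B one\<close> leaves an
    element of \<open>V\<close>, which is both skew and self-adjoint and hence zero.\<close>
  have selfadjoint_span: "\<exists>c. x = c *s e" if "x \<in> selfadjoint" for x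
  proof -
    let ?y = "x - (B one x / B one e) *s e"
    have "?y \<in> selfadjoint"
      using that e(1) subspace_selfadjoint by (simp add: vec.subspace_diff vec.subspace_scale)
    moreover have "B one ?y = 0" using e(2) by (simp add: bilinear_simps)
    ultimately have "?y \<in> V" unfolding V_eq by (simp add: selfadjoint_def)
    then have "?y = 0" using \<open>?y \<in> selfadjoint\<close> skew_Int_selfadjoint V_subset_skew by blast
    then show ?thesis by auto
  qed
  have "e \<odot> e \<in> selfadjoint" using e(1) selfadjoint_mul_selfadjoint by blast
  then obtain c where c: "e \<odot> e = c *s e" using selfadjoint_span by blast
  have "pw e (Suc k) = c ^ k *s e" for k
    by (induction k) (simp_all add: mul_scale_right c mult.commute)
  from this[of "CARD('m)"] have "c ^ CARD('m) *s e = 0"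
    using pw_eq_0[OF eM, of "Suc (CARD('m))"] by simp
  then have ee: "e \<odot> e = 0" using e0 c by simp
  have VV: "\<exists>c. v \<odot> w = c *s e" if "v \<in> V" "w \<in> V" for v w
    using that V_subset_skew skew_mul_skew selfadjoint_span by blast
  \<comment> \<open>The skew element \<open>v \<odot> e\<close> is orthogonal to \<open>one\<close>.
    Against the other two parts of \<open>y\<close>, moving \<open>v\<close> and \<open>e\<close> to
    the right always produces a factor \<open>e \<odot> e\<close>, since \<open>v \<odot> a\<close>
    and \<open>b\<close> are multiples of \<open>e\<close>.\<close>
  have ve: "v \<odot> e = 0" if v: "v \<in> V" for v
  proof (rule eq_0_if_orthogonal)
    fix y
    have ve_skew: "v \<odot> e \<in> skew" using v V_subset_skew skew_mul_selfadjoint e(1) by blast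
    obtain c a b where a: "a \<in> skew" and b: "b \<in> selfadjoint" and y: "y = c *s one + a + b"
      by (rule decomposition)
    obtain d where d: "v \<odot> a = d *s e" using VV v a skew_eq_V by blast
    obtain b' where b': "b = b' *s e" using selfadjoint_span b by blast
    have swap: "B (v \<odot> e) z = - B one (e \<odot> (v \<odot> z))" for z
      using V_skew[OF v, of e z] e(1) unfolding selfadjoint_def
      by (metis (mono_tags, lifting) mem_Collect_eq mul_one)
    have "e \<odot> (v \<odot> a) = 0" by (simp add: d mul_scale_right ee)
    moreover have "e \<odot> (v \<odot> b) = 0"
      by (simp add: b' mul_scale_right mul_left_commute[of e v] ee)
    moreover have "B (v \<odot> e) one = 0" using B_one_skew[OF ve_skew] by (simp add: commute)
    ultimately show "B (v \<odot> e) y = 0"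
      by (simp add: y bilinear_simps swap)
  qed
  have M_eq: "M = vec.span (insert e (s ` {1..n}))"
  proof
    show "M \<subseteq> vec.span (insert e (s ` {1..n}))"
    proof
      fix x assume "x \<in> M"
      then obtain a b where "a \<in> skew" "b \<in> selfadjoint" "x = a + b" by (rule M_decomposition)
      then obtain c where "x - c *s e \<in> V"
        using selfadjoint_span skew_eq_V by (metis add_diff_cancel_right')
      then show "x \<in> vec.span (insert e (s ` {1..n}))"
        unfolding vec.span_breakdown_eq by blast
    qed
    have "insert e (s ` {1..n}) \<subseteq> M"
      using eM V_subset_M vec.span_superset[of "s ` {1..n}"] by blast
    then show "vec.span (insert e (s ` {1..n})) \<subseteq> M"
      using subspace_M by (rule vec.span_minimal)
  qed
  have prod: "x \<odot> y \<in> vec.span {e}" if xy: "x \<in> M" "y \<in> M" for x y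
  proof -
    obtain a v a' v' where v: "v \<in> V" "v' \<in> V" and "x - a *s e = v" "y - a' *s e = v'"
      using xy unfolding M_eq vec.span_breakdown_eq by blast
    then have "x = v + a *s e" "y = v' + a' *s e" by (auto simp: algebra_simps)
    then have "x \<odot> y = v \<odot> v'"
      using ve v mul_commute[of e v']
      by (simp add: mul_add_left mul_add_right mul_scale_left mul_scale_right ee)
    then show ?thesis using VV[OF v] by (auto simp: vec.span_singleton)
  qed
  have "P 2 \<subseteq> vec.span {e}"
    unfolding numeral_2_eq_2 ideal_pow.simps(2)[of _ _ _ "Suc 0"] P_1
    using prod by (intro vec.span_minimal) auto
  \<comment> \<open>The nonzero vector \<open>s 1\<close> is orthogonal to \<open>one\<close> and to
    self-adjoint elements, so by nondegeneracy it pairs with some skew \<open>a\<close>; then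
    \<open>s 1 \<odot> a\<close> is a nonzero multiple of \<open>e\<close>.\<close>
  moreover have "e \<in> P 2"
  proof -
    have "s 1 \<noteq> 0"
    proof
      assume "s 1 = 0"
      then have "0 \<in> s ` {1..n}" using n_pos by force
      then show False using fac vec.dependent_zero by (auto simp: n_factor_def)
    qed
    then obtain y where y: "B (s 1) y \<noteq> 0" using eq_0_if_orthogonal by blast
    have s1: "s 1 \<in> V" using n_pos by (intro s_mem_V) simp
    obtain c a b where a: "a \<in> skew" and b: "b \<in> selfadjoint" and "y = c *s one + a + b"
      by (rule decomposition)
    moreover have "B (s 1) one = 0"
      using B_one_skew s1 V_subset_skew commute by (metis subsetD)
    moreover have "B (s 1) b = 0"
    proof -
      obtain b' where "b = b' *s e" using selfadjoint_span b by blast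
      then have "s 1 \<odot> b = 0" using ve[OF s1] by (simp add: mul_scale_right)
      then show ?thesis using V_skew[OF s1, of one b] by simp
    qed
    ultimately have "B (s 1) a \<noteq> 0" using y by (simp add: bilinear_simps)
    then have "s 1 \<odot> a \<noteq> 0" using V_skew[OF s1, of one a] by auto
    moreover obtain d where d: "s 1 \<odot> a = d *s e" using VV s1 a skew_eq_V by blast
    ultimately have "d \<noteq> 0" by auto
    then have "e = (1 / d) *s (s 1 \<odot> a)" by (simp add: d del: One_nat_def)
    moreover have "s 1 \<odot> a \<in> P 2"
      using mul_mem_P[of "s 1" a "Suc 0"] P_1 s1 a V_subset_M skew_eq_V
      by (auto simp: numeral_2_eq_2)
    ultimately show ?thesis using subspace_P by (metis vec.subspace_scale)
  qed
  then have "vec.span {e} \<subseteq> P 2" using subspace_P by (intro vec.span_minimal) auto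
  ultimately have "P 2 = vec.span {e}" by blast
  then show ?thesis using that[of e] e M_eq ve ee by blast
qed

text \<open>The basis is \<open>one\<close>, the \<open>s i\<close> and the self-adjoint
  \<open>e\<close>; deleting vectors from the front gives spanning sets of the powers of
  \<open>M\<close>. Nondegeneracy is inherited because \<open>B\<close> is a scalar multiple of
  \<open>B0\<close>.\<close>

lemma ex_proper_basis:
  obtains \<mu> where "proper_basis mul one n s \<mu>" "P 2 = vec.span {\<mu> (n + 2)}"
    "nondegenerate (B0 mul n \<mu>)"
proof -
  obtain e where e: "e \<in> selfadjoint" "B one e \<noteq> 0" and P2: "P 2 = vec.span {e}"
    and M_eq: "M = vec.span (insert e (s ` {1..n}))"
    and ve: "\<And>v. v \<in> V \<Longrightarrow> v \<odot> e = 0" and ee: "e \<odot> e = 0"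
    by (rule M_structure) blast
  have e0: "e \<noteq> 0" using e(2) by auto
  define \<mu> where "\<mu> i = (if i = 1 then one else if i = n + 2 then e else s (i - 1))" for i
  have \<mu>: "\<mu> 1 = one" "\<forall>i\<in>{1..n}. \<mu> (i + 1) = s i" "\<mu> (n + 2) = e"
    by (auto simp: \<mu>_def)
  note image = frame_eq_image[OF \<mu>(1,2), unfolded \<mu>(3)]
  \<comment> \<open>\<open>M\<close> has codimension one and omits \<open>one\<close>, so adding
    \<open>one\<close> to its spanning set fills the space.\<close>
  have "M \<subset> vec.span (frame e)"
  proof
    show "M \<subseteq> vec.span (frame e)"
      unfolding M_eq by (intro vec.span_mono) auto
    have "one \<in> vec.span (frame e)" by (intro vec.span_base) simp
    then show "M \<noteq> vec.span (frame e)" using one_notin_M by blast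
  qed
  then have "vec.dim M < vec.dim (frame e)"
    using subspace_M vec.dim_psubset[of M "frame e"] vec.span_eq_iff by metis
  then have dim_frame: "vec.dim (frame e) = CARD('m)"
    using dim_M dim_subset_UNIV_cart_gen[of "frame e"] by simp
  then have span: "vec.span (frame e) = UNIV"
    by (metis vec.dim_eq_full vec.dim_UNIV vec_dim_card vec.dimension_def)
  \<comment> \<open>A spanning set has at least \<open>n + 2\<close> elements and the image of
    \<open>n + 2\<close> indices at most that many; equality yields both injectivity of \<mu> and
    independence.\<close>
  have card: "card (frame e) = n + 2"
  proof (rule antisym)
    show "card (frame e) \<le> n + 2"
      using card_image_le[of "{1..n+2}" \<mu>] unfolding image(1) by simp
    show "n + 2 \<le> card (frame e)"
      using vec.dim_le_card[OF vec.span_superset, of "frame e"] dim_frame dim by simp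
  qed
  have basis: "proper_basis mul one n s \<mu>"
    unfolding proper_basis_def image(1)
  proof (intro conjI ballI allI)
    show "inj_on \<mu> {1..n+2}"
      by (rule eq_card_imp_inj_on) (simp, simp only: image(1) card, simp)
    show "vec.independent (frame e)"
      using span card dim by (intro vec.card_le_dim_spanning[of _ UNIV]) (auto simp: card_cart_basis)
    show "\<mu> (i + 1) = s i" if "i \<in> {1..n}" for i
      using \<mu>(2) that by blast
    show "\<mu> (n + 2) \<in> polys mul one n s" using fac by (simp add: n_factor_def)
    show "\<exists>J\<subseteq>{1..n + 2}. P k = vec.span (\<mu> ` J)" for k
    proof -
      consider "k = 0" | "k = 1" | "k = 2" | "k \<ge> 3" by linarith
      then show ?thesis
      proof cases
        case 1
        then show ?thesis using span image(1) by (intro exI[of _ "{1..n+2}"]) simp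
      next
        case 2
        then have "P k = vec.span (\<mu> ` {2..n+2})"
          unfolding image(2) M_eq[symmetric] by (simp add: P_1[simplified])
        then show ?thesis by (intro exI[of _ "{2..n+2}"]) auto
      next
        case 3
        then have "P k = vec.span (\<mu> ` {n+2})" unfolding image_insert \<mu>(3) by (simp add: P2)
        then show ?thesis by (intro exI[of _ "{n+2}"]) auto
      next
        case 4
        then have "P k = {0}"
          using P_antimono[OF 4] P_3_eq_0[OF P2 e0] vec.subspace_0[OF subspace_P[of k]] by auto
        then show ?thesis by (intro exI[of _ "{}"]) simp
      qed
    qed
  qed (use \<mu> span in simp_all)
  have P2': "P 2 = vec.span {\<mu> (n + 2)}" using P2 \<mu>(3) by simp
  have adapted: "adapted_form (B0 mul n \<mu>) e"
    using adapted_form_B0[OF basis P2'] unfolding \<mu>(3) .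
  interpret Q: symmetric_form "B0 mul n \<mu>"
    by unfold_locales (rule sym_cbilinear_B0[OF basis P2'])
  \<comment> \<open>On \<open>V\<close>, skewness gives
    \<open>B x y = - B one (x \<odot> y)\<close>, and the product is \<open>B0 mul n\<close> \<mu>
    \<open>x y\<close> times \<open>e\<close>; this is where the factor \<open>- B one e\<close>
    comes from.\<close>
  have "B u v = - B one e * B0 mul n \<mu> u v" if "u \<in> frame e" "v \<in> frame e" for u v
  proof -
    have left: "B x y = - B one (x \<odot> y)" if "x \<in> V" for x y
      using V_skew[OF that, of one y] by simp
    have "B (e \<odot> one) e = B one (e \<odot> e)" using e(1) unfolding selfadjoint_def by blast
    then have "B e e = 0" by (simp add: ee)
    note B_values = this one_isotropic commute[of e one]
    have B_V: "B one x = 0" "B x one = 0" "B x e = 0" "B e x = 0" if "x \<in> V" for x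
      using that V_eq left[OF that, of e] ve[OF that] commute[of x] by auto
    have Q_values: "B0 mul n \<mu> one one = 0" "B0 mul n \<mu> one e = - 1" "B0 mul n \<mu> e one = - 1"
      "B0 mul n \<mu> e e = 0"
      and Q_V: "\<And>x. x \<in> V \<Longrightarrow> B0 mul n \<mu> one x = 0" "\<And>x. x \<in> V \<Longrightarrow> B0 mul n \<mu> x one = 0"
        "\<And>x. x \<in> V \<Longrightarrow> B0 mul n \<mu> x e = 0" "\<And>x. x \<in> V \<Longrightarrow> B0 mul n \<mu> e x = 0"
      and mul_V: "\<And>x y. x \<in> V \<Longrightarrow> y \<in> V \<Longrightarrow> x \<odot> y = B0 mul n \<mu> x y *s e"
      using adapted Q.commute unfolding adapted_form_def by auto
    have "B x y = - B one e * B0 mul n \<mu> x y" if "x \<in> V" "y \<in> V" for x y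
      unfolding left[OF that(1)] mul_V[OF that] by (simp add: scale_right)
    then have "B x y = - B one e * B0 mul n \<mu> x y"
      if "x \<in> insert one (insert e V)" "y \<in> insert one (insert e V)" for x y
      using that B_values B_V Q_values Q_V by (elim insertE) simp_all
    moreover have "s ` {1..n} \<subseteq> V" by (rule vec.span_superset)
    ultimately show ?thesis using that by blast
  qed
  from Q.span_eqI[OF sym_cbilinear span this]
  have "B u v = 0" if "B0 mul n \<mu> u v = 0" for u v using that by (metis mult_zero_right)
  then have "nondegenerate (B0 mul n \<mu>)"
    using nondeg unfolding nondegenerate_def by blast
  with basis P2' show ?thesis by (rule that)
qed

end

theorem theorem3:
  fixes mul :: "complex^'m \<Rightarrow> complex^'m \<Rightarrow> complex^'m"
    and one :: "complex^'m"
    and n :: nat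
    and s :: "nat \<Rightarrow> complex^'m"
  assumes loc: "local_calg mul one"
    and dim: "CARD('m) = n + 2"
    and fac: "n_factor mul one n s"
  shows "(nondeg_quadric_cone (closure (orbit_cone mul one n s)) \<longleftrightarrow>
           vec.dim (ideal_pow mul one (max_ideal mul) 2) = 1 \<and>
           (\<exists>\<mu>. proper_basis mul one n s \<mu> \<and>
                ideal_pow mul one (max_ideal mul) 2 = vec.span {\<mu> (n+2)} \<and>
                nondegenerate (B0 mul n \<mu>)))
       \<and> (\<forall>\<mu>. proper_basis mul one n s \<mu> \<and>
                ideal_pow mul one (max_ideal mul) 2 = vec.span {\<mu> (n+2)} \<and>
                nondegenerate (B0 mul n \<mu>) \<longrightarrow>
              closure (orbit_cone mul one n s) = {u. B0 mul n \<mu> u u = 0})"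
proof -
  interpret n_factor_algebra mul one n s
    by unfold_locales (fact loc dim fac)+
  let ?good = "\<lambda>\<mu>. proper_basis mul one n s \<mu> \<and> P 2 = vec.span {\<mu> (n+2)} \<and>
    nondegenerate (B0 mul n \<mu>)"
  \<comment> \<open>For any such basis \<open>B0\<close> is a nondegenerate adapted form, so one
    closure computation yields both the equation of the quadric and one direction of the
    equivalence.\<close>
  have quadric: "closure (orbit_cone mul one n s) = {u. B0 mul n \<mu> u u = 0}"
    and cone: "nondeg_quadric_cone (closure (orbit_cone mul one n s))"
    and dim_1: "vec.dim (P 2) = 1" if good: "?good \<mu>" for \<mu>
  proof -
    have \<mu>: "proper_basis mul one n s \<mu>" "P 2 = vec.span {\<mu> (n+2)}" "nondegenerate (B0 mul n \<mu>)"
      using good by blast+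
    show eq: "closure (orbit_cone mul one n s) = {u. B0 mul n \<mu> u u = 0}"
      by (rule closure_orbit_cone_eq[OF adapted_form_B0[OF \<mu>(1,2)] \<mu>(3,2)
            mu_last_neq_0[OF \<mu>(1,2)] frame_span[OF \<mu>(1,2)]])
    show "nondeg_quadric_cone (closure (orbit_cone mul one n s))"
      unfolding nondeg_quadric_cone_def
      using sym_cbilinear_B0[OF \<mu>(1,2)] \<mu>(3) eq by blast
    show "vec.dim (P 2) = 1"
      using mu_last_neq_0[OF \<mu>(1,2)] unfolding \<mu>(2) by (simp add: vec.dim_span)
  qed
  have basis: "\<exists>\<mu>. ?good \<mu>" if C: "nondeg_quadric_cone (closure (orbit_cone mul one n s))"
  proof -
    obtain B where "sym_cbilinear B" "nondegenerate B"
      "closure (orbit_cone mul one n s) = {u. B u u = 0}"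
      using C unfolding nondeg_quadric_cone_def by blast
    then interpret quadric_orbit_closure mul one n s B
      by unfold_locales
    show ?thesis by (rule ex_proper_basis) blast
  qed
  show ?thesis using basis quadric cone dim_1 by blast
qed

end
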